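(* Let $q$ be a fixed odd prime power, and let $i_{GL}(n,q)$ denote the number of involutions in $GL(n,q)$. (1) As $n\to\infty$ through even integers, $$\lim_{n \rightarrow \infty} \frac{i_{GL}(n,q)}{q^{n^2/2}} = \frac{1}{2} \left[ \prod_{i \geq 1} \left(1+\frac{\sqrt{q}}{q^i}\right)^2 + \prod_{i \geq 1} \left(1-\frac{\sqrt{q}}{q^i}\right)^2 \right] = \prod_{i\ge 1} \frac{(1+q^{2-4i})^2(1-q^{-4i})}{(1-q^{-i})}.$$ (2) As $n\to\infty$ through odd integers, $$\lim_{n \rightarrow \infty} \frac{i_{GL}(n,q)}{q^{(n^2-1)/2}} = \frac{\sqrt{q}}{2} \left[ \prod_{i \geq 1} \left(1+\frac{\sqrt{q}}{q^i}\right)^2 - \prod_{i \geq 1} \left(1-\frac{\sqrt{q}}{q^i}\right)^2 \right] = 2 \prod_{i\ge 1} \frac{(1+q^{-4i})(1-q^{-8i})}{(1-q^{-i})}.$$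
   Context: $GL(n,q)$ is the group of invertible $n\times n$ matrices over the finite field with $q$ elements. "Involution" means an element $g$ with $g^2=1$ (the identity is counted). *)

theory Defs
  imports
    "HOL-Analysis.Analysis"
    "HOL-Number_Theory.Prime_Powers"
    "Jordan_Normal_Form.Matrix"
begin

text \<open>The finite field is a type \<open>'a\<close> of sort \<open>{field, finite}\<close>; the parameter \<open>q\<close> of
  \<open>GL(n,q)\<close> is \<open>CARD('a)\<close>.\<close>

definition GL :: "nat \<Rightarrow> 'a::field mat set" where
  "GL n = {A \<in> carrier_mat n n. invertible_mat A}"

definition involutions_GL :: "nat \<Rightarrow> 'a::field mat set" where
  "involutions_GL n = {A \<in> GL n. A * A = 1\<^sub>m n}"

definition i_GL :: "'a::{field, finite} itself \<Rightarrow> nat \<Rightarrow> nat" where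
  "i_GL _ n = card (involutions_GL n :: 'a mat set)"

text \<open>A limit along \<open>evens\<close> or \<open>odds\<close> is a limit as \<open>n\<close> tends to infinity through the even or odd
  natural numbers.\<close>

definition evens :: "nat filter" where
  "evens = inf sequentially (principal {n. even n})"

definition odds :: "nat filter" where
  "odds = inf sequentially (principal {n. odd n})"

end

theory Submission
  imports
    Defs
    "HOL-Library.Nat_Bijection"
    "HOL-Number_Theory.Residues"
    "Jordan_Normal_Form.Char_Poly"
begin

text \<open>As \<open>2\<close> is invertible, every involution is conjugate to exactly one diagonal matrix with
  \<open>k\<close> entries \<open>1\<close> followed by \<open>n - k\<close> entries \<open>-1\<close>, whose centraliser is \<open>GL(k,q) \<times> GL(n-k,q)\<close>.
  With \<open>u = 1/q\<close> the number of involutions is therefore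
  \<open>\<Sum>k\<le>n. q^(2k(n-k)) [n,k]\<close>, where \<open>[n,k]\<close> is the Gaussian binomial coefficient at \<open>u\<close>.
  Centring the summation at \<open>n/2\<close> and dividing by the leading power of \<open>q\<close> turns the weights into
  \<open>u^(2j^2)\<close> (\<open>n\<close> even) or \<open>u^(2j^2-2j)\<close> (\<open>n\<close> odd); since \<open>[n,k]\<close> is bounded and tends to
  \<open>1/\<Prod>(1-u^i)\<close>, dominated convergence gives a theta series as limit. The same limit applied to
  the finite \<open>q\<close>-binomial theorem is Jacobi's triple product identity, which yields both product
  forms of the theta series.\<close>

section \<open>Counting involutions\<close>

unbundle no vec_syntax

section \<open>Invertible matrices: determinant criterion, inverses, products\<close>

lemma GL_iff_det:
  "A \<in> GL n \<longleftrightarrow> A \<in> carrier_mat n n \<and> det (A :: 'a::field mat) \<noteq> 0"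
proof
  assume "A \<in> GL n"
  then obtain B where A: "A \<in> carrier_mat n n" and AB: "A * B = 1\<^sub>m n" and BA: "B * A = 1\<^sub>m (dim_row B)"
    unfolding GL_def invertible_mat_def inverts_mat_def by auto
  \<comment> \<open>\<open>invertible_mat\<close> leaves the shape of \<open>B\<close> open; the two
    product equations determine it.\<close>
  have "dim_col B = n" using arg_cong[OF AB, of dim_col] by simp
  moreover have "dim_row B = n" using arg_cong[OF BA, of dim_col] A by simp
  ultimately have B: "B \<in> carrier_mat n n" by auto
  from arg_cong[OF AB, of det] det_mult[OF A B] have "det A * det B = 1" by simp
  with A show "A \<in> carrier_mat n n \<and> det A \<noteq> 0" by auto
next
  assume "A \<in> carrier_mat n n \<and> det A \<noteq> 0"
  then have A: "A \<in> carrier_mat n n" and d: "det A \<noteq> 0" by auto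
  from det_non_zero_imp_unit[OF A d, of "()"] obtain B where
    "B \<in> carrier_mat n n" "B * A = 1\<^sub>m n" "A * B = 1\<^sub>m n"
    unfolding Units_def ring_mat_def by auto
  with A show "A \<in> GL n"
    unfolding GL_def invertible_mat_def inverts_mat_def by auto
qed

lemma GL_inverse:
  assumes "(A :: 'a::field mat) \<in> GL n"
  obtains B where "B \<in> GL n" "B * A = 1\<^sub>m n" "A * B = 1\<^sub>m n"
proof -
  from assms have A: "A \<in> carrier_mat n n" and d: "det A \<noteq> 0" by (auto simp: GL_iff_det)
  from det_non_zero_imp_unit[OF A d, of "()"] obtain B where
    B: "B \<in> carrier_mat n n" "B * A = 1\<^sub>m n" "A * B = 1\<^sub>m n"
    unfolding Units_def ring_mat_def by auto
  from det_mult[OF A B(1)] B(3) have "det B \<noteq> 0" by auto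
  with B that show ?thesis by (auto simp: GL_iff_det)
qed

lemma GL_mult: "A \<in> GL n \<Longrightarrow> B \<in> GL n \<Longrightarrow> A * (B :: 'a::field mat) \<in> GL n"
  by (auto simp: GL_iff_det det_mult)

lemma inj_on_GL_mult:
  assumes "(P :: 'a::field mat) \<in> GL n"
  shows "inj_on ((*) P) (carrier_mat n m)"
proof
  obtain Q where Q: "Q \<in> GL n" "Q * P = 1\<^sub>m n" using GL_inverse[OF assms] by auto
  have [simp]: "P \<in> carrier_mat n n" "Q \<in> carrier_mat n n"
    using assms Q(1) by (auto simp: GL_iff_det)
  fix A B assume [simp]: "A \<in> carrier_mat n m" "B \<in> carrier_mat n m" and "P * A = P * B"
  then have "Q * (P * A) = Q * (P * B)" by simp
  then have "Q * P * A = Q * P * B" by (simp add: assoc_mult_mat[of _ n n _ n _ m])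
  then have "1\<^sub>m n * A = 1\<^sub>m n * B" by (simp only: Q)
  then show "A = B" by (simp add: left_mult_one_mat[of _ n m])
qed

section \<open>The order of the general linear group\<close>

lemma card_carrier_vec: "card (carrier_vec n :: 'a::finite vec set) = CARD('a) ^ n"
proof -
  have "bij_betw (vec n) ({..<n} \<rightarrow>\<^sub>E UNIV) (carrier_vec n :: 'a vec set)"
    by (rule bij_betw_byWitness[where f' = "\<lambda>v. restrict (\<lambda>i. v $ i) {..<n}"])
       (auto intro!: ext simp: PiE_def extensional_def)
  then show ?thesis by (simp flip: bij_betw_same_card add: card_PiE)
qed

lemma card_carrier_mat: "card (carrier_mat m n :: 'a::finite mat set) = CARD('a) ^ (m * n)"
proof -
  have "bij_betw (mat m n) ({..<m} \<times> {..<n} \<rightarrow>\<^sub>E UNIV) (carrier_mat m n :: 'a mat set)"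
    by (rule bij_betw_byWitness[where f' = "\<lambda>A. restrict (\<lambda>ij. A $$ ij) ({..<m} \<times> {..<n})"])
       (auto intro!: ext simp: PiE_def extensional_def)
  then show ?thesis by (simp flip: bij_betw_same_card add: card_PiE)
qed

lemma finite_carrier_mat: "finite (carrier_mat m n :: 'a::finite mat set)"
  by (rule card_ge_0_finite) (simp add: card_carrier_mat zero_less_card_finite)

lemma finite_GL: "finite (GL n :: 'a::{field,finite} mat set)"
  by (rule finite_subset[OF _ finite_carrier_mat[of n n]]) (auto simp: GL_def)

text \<open>Basis completion, made explicit. If the top entry of the vector is nonzero, the identity
  with its first column replaced is lower triangular with nonzero diagonal; otherwise one row
  operation reduces to that case.\<close>

lemma ex_GL_col_0:
  assumes v: "(v :: 'a::field vec) \<in> carrier_vec (Suc n)" and "v \<noteq> 0\<^sub>v (Suc n)"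
  shows "\<exists>P \<in> GL (Suc n). col P 0 = v"
proof -
  have *: "\<exists>P \<in> GL (Suc n). col P 0 = v"
    if v: "(v :: 'a vec) \<in> carrier_vec (Suc n)" and v0: "v $ 0 \<noteq> 0" for v
  proof
    let ?P = "mat (Suc n) (Suc n) (\<lambda>(i,j). if j = 0 then v $ i else if i = j then 1 else 0)"
    have "det ?P = prod_list (diag_mat ?P)"
      by (rule det_lower_triangular[of "Suc n"]) auto
    also have "\<dots> \<noteq> 0" using v0 by (auto simp: diag_mat_def prod_list_zero_iff simp del: upt_Suc)
    finally show "?P \<in> GL (Suc n)" by (auto simp: GL_iff_det)
    show "col ?P 0 = v" using v by (intro eq_vecI) auto
  qed
  show ?thesis
  proof (cases "v $ 0 = 0")
    case False
    with * v show ?thesis by blast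
  next
    case True
    obtain k where k: "k < Suc n" "v $ k \<noteq> 0"
      using assms eq_vecI[of "0\<^sub>v (Suc n)" v] by auto
    with True have k0: "k \<noteq> 0" by (cases k) auto
    \<comment> \<open>\<open>u\<close> is \<open>v\<close> with the nonzero entry
      \<open>v $ k\<close> copied to the top; subtracting row \<open>k\<close> from row
      \<open>0\<close> then restores the top entry \<open>0\<close>.\<close>
    define u where "u = vec (Suc n) (\<lambda>i. if i = 0 then v $ k else v $ i)"
    obtain P where P: "P \<in> GL (Suc n)" "col P 0 = u"
      using *[of u] k unfolding u_def by auto
    then have P': "P \<in> carrier_mat (Suc n) (Suc n)" by (auto simp: GL_iff_det)
    have Pi: "P $$ (i, 0) = u $ i" if "i < Suc n" for i
      using arg_cong[OF P(2), of "\<lambda>v. v $ i"] that P' by auto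
    have "addrow (- 1) 0 k P \<in> GL (Suc n)"
      using P P' k k0 by (auto simp: GL_iff_det det_addrow)
    moreover have "col (addrow (- 1) 0 k P) 0 = v"
      using P' v k k0 True by (intro eq_vecI) (auto simp: Pi, auto simp: u_def)
    ultimately show ?thesis by blast
  qed
qed

lemma col_mat_mult:
  assumes "A \<in> carrier_mat m n" "B \<in> carrier_mat n l" "j < l"
  shows "col (A * B) j = A *\<^sub>v col B j"
  using assms by (intro eq_vecI) auto

lemma mat_mult_unit_vec:
  assumes "(A :: 'a::semiring_1 mat) \<in> carrier_mat m n" "j < n"
  shows "A *\<^sub>v unit_vec n j = col A j"
  using assms by (intro eq_vecI) auto

lemma card_by_fibres:
  assumes "finite S" and "\<And>y. y \<in> f ` S \<Longrightarrow> card {x \<in> S. f x = y} = c"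
  shows "card S = card (f ` S) * c"
proof -
  have "card S = (\<Sum>y\<in>f ` S. card {x \<in> S. f x = y})"
    using sum.image_gen[OF assms(1), of "\<lambda>_. 1::nat" f] by simp
  then show ?thesis using assms(2) by simp
qed

text \<open>A block triangular determinant with upper left entry \<open>1\<close> equals that of the
  lower right block, so \<open>w\<close> is free and only \<open>B\<close> is constrained. This
  serves both as the base fibre in the count of \<open>GL\<close> and as the shape of an involution
  that fixes the first basis vector.\<close>

lemma GL_col_0_unit:
  "{A \<in> GL (Suc n). col A 0 = unit_vec (Suc n) 0}
    = (\<lambda>(w, B). four_block_mat (1\<^sub>m 1) w (0\<^sub>m n 1) B) ` (carrier_mat 1 n \<times> (GL n :: 'a::field mat set))"
  (is "?L = ?f ` ?R")
proof (intro equalityI subsetI)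
  fix A assume "A \<in> ?L"
  then have A: "A \<in> carrier_mat (Suc n) (Suc n)" and d: "det A \<noteq> 0"
    and c: "col A 0 = unit_vec (Suc n) 0" by (auto simp: GL_iff_det)
  obtain A1 w A3 B where s: "split_block A 1 1 = (A1, w, A3, B)" by (metis prod_cases4)
  from split_block[OF s, of n n] A have sb: "A1 \<in> carrier_mat 1 1" "w \<in> carrier_mat 1 n"
    "A3 \<in> carrier_mat n 1" "B \<in> carrier_mat n n" "A = four_block_mat A1 w A3 B" by auto
  have Ai: "A $$ (i, 0) = (if i = 0 then 1 else 0)" if "i < Suc n" for i
    using arg_cong[OF c, of "\<lambda>v. v $ i"] that A by auto
  have "A1 = 1\<^sub>m 1" using Ai[of 0] sb(1-4) by (intro eq_matI) (auto simp: sb(5))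
  moreover have "A3 = 0\<^sub>m n 1"
  proof (rule eq_matI)
    fix i j assume "i < dim_row (0\<^sub>m n 1 :: 'a mat)" "j < dim_col (0\<^sub>m n 1 :: 'a mat)"
    then show "A3 $$ (i, j) = 0\<^sub>m n 1 $$ (i, j)" using Ai[of "Suc i"] sb(1-4) by (auto simp: sb(5))
  qed (use sb in auto)
  ultimately have Aeq: "A = four_block_mat (1\<^sub>m 1) w (0\<^sub>m n 1) B" using sb by simp
  have "det A = det B" unfolding Aeq
    by (subst det_four_block_mat_lower_left_zero[of _ 1 _ n]) (use sb in auto)
  with d sb have "(w, B) \<in> ?R" by (auto simp: GL_iff_det)
  then show "A \<in> ?f ` ?R" using Aeq by auto
next
  fix A assume "A \<in> ?f ` ?R"
  then obtain w B where w: "w \<in> carrier_mat 1 n" and B: "B \<in> carrier_mat n n" "det B \<noteq> 0"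
    and A: "A = four_block_mat (1\<^sub>m 1) w (0\<^sub>m n 1) B" by (auto simp: GL_iff_det)
  have "det A = det B" unfolding A
    by (subst det_four_block_mat_lower_left_zero[of _ 1 _ n]) (use w B in auto)
  moreover have "A \<in> carrier_mat (Suc n) (Suc n)"
    using four_block_carrier_mat[of "1\<^sub>m 1" 1 1 B n n] B by (auto simp: A)
  moreover have "col A 0 = unit_vec (Suc n) 0"
    using B by (intro eq_vecI) (auto simp: A)
  ultimately show "A \<in> ?L" using B by (auto simp: GL_iff_det)
qed

lemma four_block_mat_inject:
  assumes "four_block_mat A B C D = four_block_mat A' B' C' D'"
    and "A \<in> carrier_mat m m'" "B \<in> carrier_mat m n'" "C \<in> carrier_mat n m'" "D \<in> carrier_mat n n'"
    and "A' \<in> carrier_mat m m'" "B' \<in> carrier_mat m n'" "C' \<in> carrier_mat n m'" "D' \<in> carrier_mat n n'"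
  shows "A = A' \<and> B = B' \<and> C = C' \<and> D = D'"
proof -
  have e: "four_block_mat A B C D $$ (i, j) = four_block_mat A' B' C' D' $$ (i, j)" for i j
    using assms(1) by simp
  show ?thesis
  proof (intro conjI)
    show "A = A'"
    proof (rule eq_matI)
      fix i j assume "i < dim_row A'" "j < dim_col A'"
      then show "A $$ (i, j) = A' $$ (i, j)" using e[of i j] assms(2-) by auto
    qed (use assms in auto)
    show "B = B'"
    proof (rule eq_matI)
      fix i j assume "i < dim_row B'" "j < dim_col B'"
      then show "B $$ (i, j) = B' $$ (i, j)" using e[of i "m' + j"] assms(2-) by auto
    qed (use assms in auto)
    show "C = C'"
    proof (rule eq_matI)
      fix i j assume "i < dim_row C'" "j < dim_col C'"
      then show "C $$ (i, j) = C' $$ (i, j)" using e[of "m + i" j] assms(2-) by auto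
    qed (use assms in auto)
    show "D = D'"
    proof (rule eq_matI)
      fix i j assume "i < dim_row D'" "j < dim_col D'"
      then show "D $$ (i, j) = D' $$ (i, j)" using e[of "m + i" "m' + j"] assms(2-) by auto
    qed (use assms in auto)
  qed
qed

text \<open>Count by the first column. The possible columns are the nonzero vectors, and left
  multiplication by an invertible matrix with first column \<open>v\<close> carries the fibre over
  the first unit vector bijectively onto the fibre over \<open>v\<close>.\<close>

lemma card_GL_Suc:
  "card (GL (Suc n) :: 'a::{field,finite} mat set)
    = (CARD('a) ^ Suc n - 1) * (CARD('a) ^ n * card (GL n :: 'a mat set))"
proof -
  let ?G = "GL (Suc n) :: 'a mat set"
  let ?U = "{A \<in> ?G. col A 0 = unit_vec (Suc n) 0}"
  have "inj_on (\<lambda>(w, B). four_block_mat (1\<^sub>m 1) w (0\<^sub>m n 1) B) (carrier_mat 1 n \<times> (GL n :: 'a mat set))"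
    by (rule inj_onI) (auto simp: GL_iff_det dest!: four_block_mat_inject[of _ _ _ _ _ _ _ _ 1 1 n n])
  then have card_U: "card ?U = CARD('a) ^ n * card (GL n :: 'a mat set)"
    unfolding GL_col_0_unit by (simp add: card_image card_cartesian_product card_carrier_mat)
  have img: "(\<lambda>A. col A 0) ` ?G = carrier_vec (Suc n) - {0\<^sub>v (Suc n)}"
  proof (intro equalityI subsetI)
    fix v assume "v \<in> (\<lambda>A. col A 0) ` ?G"
    then obtain A where A: "A \<in> carrier_mat (Suc n) (Suc n)" "det A \<noteq> 0" "v = col A 0"
      by (auto simp: GL_iff_det)
    have "A *\<^sub>v unit_vec (Suc n) 0 = v" using A by (simp add: mat_mult_unit_vec)
    with A det_0_iff_vec_prod_zero_field[OF A(1)] have "v \<noteq> 0\<^sub>v (Suc n)"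
      by (metis unit_vec_carrier unit_vec_nonzero zero_less_Suc)
    moreover have "v \<in> carrier_vec (Suc n)" unfolding A(3) using carrier_matD(1)[OF A(1)]
      by (intro carrier_vecI) (simp only: dim_col)
    ultimately show "v \<in> carrier_vec (Suc n) - {0\<^sub>v (Suc n)}" by simp
  next
    fix v :: "'a vec" assume "v \<in> carrier_vec (Suc n) - {0\<^sub>v (Suc n)}"
    then obtain P where "P \<in> ?G" "col P 0 = v" using ex_GL_col_0[of v n] by blast
    then show "v \<in> (\<lambda>A. col A 0) ` ?G" by blast
  qed
  have fib: "card {A \<in> ?G. col A 0 = v} = card ?U" if "v \<in> (\<lambda>A. col A 0) ` ?G" for v
  proof -
    from that obtain P where P: "P \<in> ?G" "col P 0 = v" by auto
    obtain Q where Q: "Q \<in> ?G" "Q * P = 1\<^sub>m (Suc n)" "P * Q = 1\<^sub>m (Suc n)" using GL_inverse[OF P(1)] .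
    have c: "P \<in> carrier_mat (Suc n) (Suc n)" "Q \<in> carrier_mat (Suc n) (Suc n)"
      using P Q by (auto simp: GL_iff_det)
    have "{A \<in> ?G. col A 0 = v} = (*) P ` ?U"
    proof (intro equalityI subsetI)
      fix A assume A: "A \<in> {A \<in> ?G. col A 0 = v}"
      then have Ac: "A \<in> carrier_mat (Suc n) (Suc n)" by (auto simp: GL_iff_det)
      have "col (Q * A) 0 = Q *\<^sub>v col P 0" using A P Ac c by (subst col_mat_mult) auto
      also have "\<dots> = col (Q * P) 0" using c by (subst col_mat_mult) auto
      finally have "Q * A \<in> ?U" using Q A by (auto simp: GL_mult)
      moreover have "A = P * (Q * A)"
        using c Ac Q by (metis assoc_mult_mat left_mult_one_mat)
      ultimately show "A \<in> (*) P ` ?U" by blast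
    next
      fix A assume "A \<in> (*) P ` ?U"
      then obtain B where B: "B \<in> ?G" "col B 0 = unit_vec (Suc n) 0" "A = P * B" by auto
      then have Bc: "B \<in> carrier_mat (Suc n) (Suc n)" by (auto simp: GL_iff_det)
      have "col A 0 = v" unfolding B(3)
        using B c Bc P by (subst col_mat_mult) (auto simp: mat_mult_unit_vec)
      then show "A \<in> {A \<in> ?G. col A 0 = v}" using B P by (auto simp: GL_mult)
    qed
    moreover have "inj_on ((*) P) ?U"
      by (rule inj_on_subset[OF inj_on_GL_mult[OF P(1), of "Suc n"]]) (auto simp: GL_iff_det)
    ultimately show ?thesis by (simp add: card_image)
  qed
  have "card ?G = card ((\<lambda>A. col A 0) ` ?G) * card ?U"
    by (rule card_by_fibres[OF finite_GL fib])
  then show ?thesis unfolding img card_U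
    by (simp add: card_Diff_singleton card_carrier_vec)
qed

section \<open>Similarity classes and centralisers\<close>

text \<open>An intertwining equation with a single invertible \<open>P\<close> replaces the pair of
  mutually inverse witnesses; in this form the conjugating matrices can be counted.\<close>

lemma similar_mat_iff_GL:
  assumes D: "(D :: 'a::field mat) \<in> carrier_mat n n"
  shows "similar_mat A D \<longleftrightarrow> A \<in> carrier_mat n n \<and> (\<exists>P \<in> GL n. A * P = P * D)"
proof
  assume "similar_mat A D"
  then obtain P Q where w: "similar_mat_wit D A P Q"
    using similar_mat_sym unfolding similar_mat_def by blast
  note w = similar_mat_witD2[OF D w]
  have "det Q \<noteq> 0" using det_mult[of Q n P] w by auto
  moreover have "A * Q = Q * P * (A * Q)" using w by (simp add: left_mult_one_mat[of _ n n])
  moreover have "\<dots> = Q * (P * A * Q)" using w(4-) by (simp add: assoc_mult_mat[of _ n n _ n _ n])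
  ultimately show "A \<in> carrier_mat n n \<and> (\<exists>P \<in> GL n. A * P = P * D)"
    using w by (auto simp: GL_iff_det)
next
  assume "A \<in> carrier_mat n n \<and> (\<exists>P \<in> GL n. A * P = P * D)"
  then obtain P where A: "A \<in> carrier_mat n n" and P: "P \<in> GL n" "A * P = P * D" by auto
  obtain Q where Q: "Q \<in> GL n" "Q * P = 1\<^sub>m n" "P * Q = 1\<^sub>m n" using GL_inverse[OF P(1)] .
  have c: "P \<in> carrier_mat n n" "Q \<in> carrier_mat n n" using P Q by (auto simp: GL_iff_det)
  have "P * D * Q = A * (P * Q)" using A c by (simp flip: P(2) add: assoc_mult_mat[of _ n n _ n _ n])
  then have "A = P * D * Q" using A Q by simp
  then show "similar_mat A D" using A D c Q by (intro similar_matI[of _ _ P Q n]) auto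
qed

text \<open>Orbit-stabiliser for conjugation: \<open>P\<close> is sent to its conjugate of
  \<open>D\<close>, the image is the similarity class, and each fibre is a left coset of the
  centraliser.\<close>

lemma card_similarity_class:
  assumes D: "(D :: 'a::{field,finite} mat) \<in> carrier_mat n n"
  shows "card (GL n :: 'a mat set) = card {A. similar_mat A D} * card {S \<in> GL n. S * D = D * S}"
proof -
  \<comment> \<open>The conjugate of \<open>D\<close> by \<open>P\<close>, characterised by the
    intertwining equation so that no choice of inverse enters the definition.\<close>
  define f where "f P = (THE A. A \<in> carrier_mat n n \<and> A * P = P * D)" for P
  have f: "f P = A \<longleftrightarrow> A * P = P * D" if P: "P \<in> GL n" and A: "A \<in> carrier_mat n n" for P A
  proof -
    obtain Q where Q: "Q \<in> GL n" "Q * P = 1\<^sub>m n" "P * Q = 1\<^sub>m n" using GL_inverse[OF P] .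
    have c: "P \<in> carrier_mat n n" "Q \<in> carrier_mat n n" using P Q by (auto simp: GL_iff_det)
    have *: "B * P = P * D \<longleftrightarrow> B = P * D * Q" if B: "B \<in> carrier_mat n n" for B
    proof
      assume "B * P = P * D"
      then have "P * D * Q = B * (P * Q)" using B c D by (metis assoc_mult_mat)
      then show "B = P * D * Q" using B Q by simp
    next
      assume "B = P * D * Q"
      then have "B * P = P * D * (Q * P)" using c D by (simp add: assoc_mult_mat[of _ n n _ n _ n])
      then show "B * P = P * D" using Q c D by simp
    qed
    have "f P = P * D * Q" unfolding f_def
      by (rule the_equality) (use * c D in auto)
    with * A show ?thesis by auto
  qed
  have f_carrier: "f P \<in> carrier_mat n n" if P: "P \<in> GL n" for P
  proof -
    obtain Q where Q: "Q \<in> GL n" "Q * P = 1\<^sub>m n" "P * Q = 1\<^sub>m n" using GL_inverse[OF P] .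
    have c: "P \<in> carrier_mat n n" "Q \<in> carrier_mat n n" using P Q by (auto simp: GL_iff_det)
    have "P * D * Q * P = P * D * (Q * P)" using c D by (simp add: assoc_mult_mat[of _ n n _ n _ n])
    then have "f P = P * D * Q" using f[OF P, of "P * D * Q"] Q c D by simp
    then show ?thesis using c D by simp
  qed
  have img: "f ` GL n = {A. similar_mat A D}"
    using f f_carrier unfolding similar_mat_iff_GL[OF D] by (auto simp: image_iff)
  have fib: "card {P \<in> GL n. f P = A} = card {S \<in> GL n. S * D = D * S}" if "A \<in> f ` GL n" for A
  proof -
    from that obtain P where P: "P \<in> GL n" "f P = A" by auto
    obtain Q where Q: "Q \<in> GL n" "Q * P = 1\<^sub>m n" "P * Q = 1\<^sub>m n" using GL_inverse[OF P(1)] .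
    have c: "P \<in> carrier_mat n n" "Q \<in> carrier_mat n n" using P Q by (auto simp: GL_iff_det)
    have A: "A \<in> carrier_mat n n" using f_carrier P by auto
    have AP: "A * P = P * D" using f[OF P(1) A] P by simp
    note as = assoc_mult_mat[of _ n n _ n _ n]
    have "{R \<in> GL n. f R = A} = (*) P ` {S \<in> GL n. S * D = D * S}"
    proof (intro equalityI subsetI)
      fix R assume "R \<in> {R \<in> GL n. f R = A}"
      then have R: "R \<in> GL n" "A * R = R * D" using f A by auto
      then have Rc: "R \<in> carrier_mat n n" by (auto simp: GL_iff_det)
      have A_eq: "A = P * D * Q"
      proof -
        have "P * D * Q = A * (P * Q)" using A c by (simp flip: AP add: as)
        then show ?thesis using A Q by simp
      qed
      have "Q * R * D = Q * (P * D * Q * R)" using R(2) A_eq Rc D c by (simp add: as)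
      also have "\<dots> = Q * P * (D * (Q * R))" using Rc D c by (simp add: as)
      also have "\<dots> = D * (Q * R)" using Rc D c Q by simp
      finally have "Q * R \<in> {S \<in> GL n. S * D = D * S}" using R Q by (auto intro: GL_mult)
      moreover have "R = P * (Q * R)"
        using c Rc Q by (metis assoc_mult_mat left_mult_one_mat)
      ultimately show "R \<in> (*) P ` {S \<in> GL n. S * D = D * S}" by blast
    next
      fix R assume "R \<in> (*) P ` {S \<in> GL n. S * D = D * S}"
      then obtain S where S: "S \<in> GL n" "S * D = D * S" "R = P * S" by auto
      then have Sc: "S \<in> carrier_mat n n" by (auto simp: GL_iff_det)
      have "A * R = P * D * S" using S Sc A c AP by (metis assoc_mult_mat)
      also have "\<dots> = R * D" using S(2,3) Sc D c by (simp add: as)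
      finally show "R \<in> {R \<in> GL n. f R = A}" using f[of R A] S P A by (auto intro: GL_mult)
    qed
    moreover have "inj_on ((*) P) {S \<in> GL n. S * D = D * S}"
      by (rule inj_on_subset[OF inj_on_GL_mult[OF P(1), of n]]) (auto simp: GL_iff_det)
    ultimately show ?thesis by (simp add: card_image)
  qed
  show ?thesis using card_by_fibres[OF finite_GL fib] unfolding img .
qed

section \<open>Classification of involutions by signature\<close>

definition signature_mat :: "nat \<Rightarrow> nat \<Rightarrow> 'a::field mat" where
  "signature_mat k l = four_block_mat (1\<^sub>m k) (0\<^sub>m k l) (0\<^sub>m l k) (- 1\<^sub>m l)"

lemma signature_mat_carrier [simp]: "signature_mat k l \<in> carrier_mat (k + l) (k + l)"
  unfolding signature_mat_def by auto

lemma uminus_zero_mat [simp]: "- 0\<^sub>m m n = (0\<^sub>m m n :: 'a::group_add mat)"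
  by (rule eq_matI) auto

lemma signature_mat_square: "signature_mat k l * signature_mat k l = (1\<^sub>m (k + l) :: 'a::field mat)"
proof -
  have "(- 1\<^sub>m l) * (- 1\<^sub>m l) = (1\<^sub>m l :: 'a mat)"
    by (simp add: uminus_mult_left_mat uminus_mult_right_mat)
  then show ?thesis unfolding signature_mat_def
    by (subst mult_four_block_mat[of _ k k _ l _ l _ _ k _ l]) auto
qed

lemma uminus_eq_self_mat:
  assumes "(2 :: 'a::field) \<noteq> 0" "- A = (A :: 'a mat)" "A \<in> carrier_mat m n"
  shows "A = 0\<^sub>m m n"
proof (rule eq_matI)
  fix i j assume "i < dim_row (0\<^sub>m m n :: 'a mat)" "j < dim_col (0\<^sub>m m n :: 'a mat)"
  moreover from this have "- (A $$ (i,j)) = A $$ (i,j)"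
    using arg_cong[OF assms(2), of "\<lambda>A. A $$ (i,j)"] assms(3) by auto
  then have "2 * A $$ (i,j) = 0" by (metis mult_2 neg_eq_iff_add_eq_0)
  ultimately show "A $$ (i,j) = 0\<^sub>m m n $$ (i,j)" using assms(1) by auto
qed (use assms in auto)

text \<open>Comparing the off-diagonal blocks of the two products shows that they equal their own
  negatives, hence vanish because \<open>2\<close> is invertible; the determinant then factors over
  the diagonal blocks.\<close>

lemma centralizer_signature_mat:
  assumes two: "(2 :: 'a::field) \<noteq> 0"
  shows "{S \<in> GL (k + l). S * signature_mat k l = signature_mat k l * S}
    = (\<lambda>(A, B). four_block_mat A (0\<^sub>m k l) (0\<^sub>m l k) B) ` (GL k \<times> (GL l :: 'a mat set))"
  (is "?L = ?f ` ?R")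
proof (intro equalityI subsetI)
  fix S assume "S \<in> ?L"
  then have S: "S \<in> carrier_mat (k + l) (k + l)" and d: "det S \<noteq> 0"
    and c: "S * signature_mat k l = signature_mat k l * S" by (auto simp: GL_iff_det)
  obtain A B C D where s: "split_block S k k = (A, B, C, D)" by (metis prod_cases4)
  from split_block[OF s, of l l] S have sb: "A \<in> carrier_mat k k" "B \<in> carrier_mat k l"
    "C \<in> carrier_mat l k" "D \<in> carrier_mat l l" "S = four_block_mat A B C D" by auto
  have "S * signature_mat k l = four_block_mat A (- B) C (- D)"
    unfolding sb(5) signature_mat_def
    using sb(1-4) by (subst mult_four_block_mat[of _ k k _ l _ l _ _ k _ l]) auto
  moreover have "signature_mat k l * S = four_block_mat A B (- C) (- D)"
    unfolding sb(5) signature_mat_def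
    using sb(1-4) by (subst mult_four_block_mat[of _ k k _ l _ l _ _ k _ l]) auto
  ultimately have "four_block_mat A (- B) C (- D) = four_block_mat A B (- C) (- D)"
    using c by simp
  from four_block_mat_inject[OF this, of k k l l] sb have "- B = B" "- C = C" by auto
  with two sb have "B = 0\<^sub>m k l" "C = 0\<^sub>m l k" by (auto intro!: uminus_eq_self_mat)
  then have Seq: "S = four_block_mat A (0\<^sub>m k l) (0\<^sub>m l k) D" using sb by simp
  have "det S = det A * det D" unfolding Seq
    by (subst det_four_block_mat_lower_left_zero[of _ k _ l]) (use sb in auto)
  with d sb have "(A, D) \<in> ?R" by (auto simp: GL_iff_det)
  then show "S \<in> ?f ` ?R" using Seq by auto
next
  fix S assume "S \<in> ?f ` ?R"
  then obtain A D where A: "A \<in> carrier_mat k k" "det A \<noteq> 0" and D: "D \<in> carrier_mat l l" "det D \<noteq> 0"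
    and S: "S = four_block_mat A (0\<^sub>m k l) (0\<^sub>m l k) D" by (auto simp: GL_iff_det)
  have "det S = det A * det D" unfolding S
    by (subst det_four_block_mat_lower_left_zero[of _ k _ l]) (use A D in auto)
  moreover have "S \<in> carrier_mat (k + l) (k + l)"
    using A D by (auto simp: S)
  moreover have "S * signature_mat k l = four_block_mat A (0\<^sub>m k l) (0\<^sub>m l k) (- D)"
    unfolding S signature_mat_def
    using A D by (subst mult_four_block_mat[of _ k k _ l _ l _ _ k _ l]) auto
  moreover have "signature_mat k l * S = four_block_mat A (0\<^sub>m k l) (0\<^sub>m l k) (- D)"
    unfolding S signature_mat_def
    using A D by (subst mult_four_block_mat[of _ k k _ l _ l _ _ k _ l]) auto
  ultimately show "S \<in> ?L" using A D by (auto simp: GL_iff_det)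
qed

lemma card_centralizer_signature_mat:
  assumes two: "(2 :: 'a::{field,finite}) \<noteq> 0"
  shows "card {S \<in> GL (k + l). S * signature_mat k l = signature_mat k l * (S :: 'a mat)}
    = card (GL k :: 'a mat set) * card (GL l :: 'a mat set)"
proof -
  have "inj_on (\<lambda>(A, B). four_block_mat A (0\<^sub>m k l) (0\<^sub>m l k) B) (GL k \<times> (GL l :: 'a mat set))"
    by (rule inj_onI) (auto simp: GL_iff_det dest!: four_block_mat_inject[of _ _ _ _ _ _ _ _ k k l l])
  then show ?thesis unfolding centralizer_signature_mat[OF two]
    by (simp add: card_image card_cartesian_product)
qed

text \<open>Splits off one entry \<open>1\<close>, as required when a fixed vector is removed in the
  induction that classifies involutions.\<close>

lemma signature_mat_Suc:
  "signature_mat (Suc k) l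
    = four_block_mat (1\<^sub>m 1) (0\<^sub>m 1 (k + l)) (0\<^sub>m (k + l) 1) (signature_mat k l :: 'a::field mat)"
  unfolding signature_mat_def by (rule eq_matI) auto

text \<open>The premise on \<open>w\<close> is what the upper right block says when the square of
  the first matrix is the identity. A unipotent conjugation then removes \<open>w\<close>.\<close>

lemma similar_mat_involution_four_block:
  assumes two: "(2 :: 'a::field) \<noteq> 0"
    and w: "w \<in> carrier_mat 1 n" and B: "B \<in> carrier_mat n n"
    and wB: "w + w * B = 0\<^sub>m 1 n"
  shows "similar_mat (four_block_mat (1\<^sub>m 1) w (0\<^sub>m n 1) B) 
    (four_block_mat (1\<^sub>m 1) (0\<^sub>m 1 n) (0\<^sub>m n 1) (B :: 'a mat))"
proof -
  \<comment> \<open>Conjugating the block diagonal matrix produces the upper right block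
    \<open>x - x * B\<close>, which is \<open>2x\<close> since \<open>x * B = - x\<close>; hence
    \<open>x\<close> is half of \<open>w\<close>.\<close>
  define x where "x = (1 / 2 :: 'a) \<cdot>\<^sub>m w"
  have x: "x \<in> carrier_mat 1 n" using w by (simp add: x_def)
  have wx: "w = x + x" using w two by (intro eq_matI) (auto simp: x_def field_simps)
  have "(1/2) \<cdot>\<^sub>m (w + w * B) = 0\<^sub>m 1 n" unfolding wB by auto
  then have xB: "x + x * B = 0\<^sub>m 1 n" unfolding x_def using w B
    by (simp add: mult_smult_assoc_mat[of _ 1 n _ n] add_smult_distrib_left_mat[of _ 1 n])
  have xB': "x * B = - x"
    using arg_cong[OF xB, of "\<lambda>A. - x + A"] x B
    by (simp flip: assoc_add_mat[of _ 1 n] add: uminus_l_inv_mat[of _ 1 n])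
  let ?P = "four_block_mat (1\<^sub>m 1) (- x) (0\<^sub>m n 1) (1\<^sub>m n)"
  let ?Q = "four_block_mat (1\<^sub>m 1) x (0\<^sub>m n 1) (1\<^sub>m n)"
  let ?E = "four_block_mat (1\<^sub>m 1) (0\<^sub>m 1 n) (0\<^sub>m n 1) B"
  have PQ: "?P * ?Q = 1\<^sub>m (1 + n)" 
    by (subst mult_four_block_mat[of _ 1 1 _ n _ n _ _ 1 _ n]) (use x add_uminus_minus_mat[OF x x] in auto)
  have QP: "?Q * ?P = 1\<^sub>m (1 + n)" 
    by (subst mult_four_block_mat[of _ 1 1 _ n _ n _ _ 1 _ n]) (use x in auto)
  have PE: "?P * ?E = four_block_mat (1\<^sub>m 1) x (0\<^sub>m n 1) B"
    by (subst mult_four_block_mat[of _ 1 1 _ n _ n _ _ 1 _ n])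
       (use x B in \<open>auto simp: uminus_mult_left_mat[symmetric] xB'\<close>)
  have "?P * ?E * ?Q = four_block_mat (1\<^sub>m 1) w (0\<^sub>m n 1) B" unfolding PE
    by (subst mult_four_block_mat[of _ 1 1 _ n _ n _ _ 1 _ n]) (use x B in \<open>auto simp: wx\<close>)
  then show ?thesis using PQ QP x B w
    by (intro similar_matI[of _ _ ?P ?Q "1 + n"]) auto
qed

text \<open>Induction on \<open>n\<close>. Vectors of the form \<open>v + A v\<close> are fixed by
  \<open>A\<close>. If all of them vanish then \<open>A = -1\<close>; otherwise a nonzero one
  becomes the first basis vector and splits off, leaving an involution of size one less.\<close>

lemma involution_similar_signature:
  assumes two: "(2 :: 'a::field) \<noteq> 0"
  shows "A \<in> carrier_mat n n \<Longrightarrow> A * A = 1\<^sub>m n \<Longrightarrow>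
    \<exists>k\<le>n. similar_mat A (signature_mat k (n - k) :: 'a mat)"
proof (induction n arbitrary: A)
  case 0
  have "signature_mat 0 0 = (1\<^sub>m 0 :: 'a mat)" unfolding signature_mat_def by (rule eq_matI) auto
  moreover have "A = 1\<^sub>m 0" using 0 by (intro eq_matI) auto
  ultimately show ?case using similar_mat_refl[of "1\<^sub>m 0 :: 'a mat" 0] by auto
next
  case (Suc n)
  note A = Suc.prems(1)
  show ?case
  proof (cases "\<exists>v \<in> carrier_vec (Suc n). v + A *\<^sub>v v \<noteq> 0\<^sub>v (Suc n)")
    case False
    have "A = - 1\<^sub>m (Suc n)"
    proof (rule eq_matI)
      fix i j assume "i < dim_row (- 1\<^sub>m (Suc n) :: 'a mat)" "j < dim_col (- 1\<^sub>m (Suc n) :: 'a mat)"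
      then have ij: "i < Suc n" "j < Suc n" by auto
      then have e: "unit_vec (Suc n) j + col A j = 0\<^sub>v (Suc n)"
        using False mat_mult_unit_vec[OF A ij(2)] by (metis unit_vec_carrier)
      have "unit_vec (Suc n) j $ i + A $$ (i, j) = 0"
        using arg_cong[OF e, of "\<lambda>v. v $ i"] ij A by auto
      then show "A $$ (i, j) = (- 1\<^sub>m (Suc n)) $$ (i, j)"
        using ij by (auto simp: eq_neg_iff_add_eq_0 add.commute unit_vec_def)
    qed (use A in auto)
    moreover have "signature_mat 0 (Suc n) = (- 1\<^sub>m (Suc n) :: 'a mat)"
      unfolding signature_mat_def by (rule eq_matI) auto
    ultimately show ?thesis using similar_mat_refl[OF A] by (intro exI[of _ 0]) auto
  next
    case True
    then obtain v where v: "v \<in> carrier_vec (Suc n)" "v + A *\<^sub>v v \<noteq> 0\<^sub>v (Suc n)" by auto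
    have "A *\<^sub>v (v + A *\<^sub>v v) = A *\<^sub>v v + A * A *\<^sub>v v"
      using A v by (simp add: mult_add_distrib_mat_vec[of _ "Suc n" "Suc n"]
          assoc_mult_mat_vec[of _ "Suc n" "Suc n" _ "Suc n"])
    also have "\<dots> = v + A *\<^sub>v v" 
      using A v Suc.prems(2) by (simp add: comm_add_vec[of v "Suc n"])
    finally have fix_v: "A *\<^sub>v (v + A *\<^sub>v v) = v + A *\<^sub>v v" .
    have "v + A *\<^sub>v v \<in> carrier_vec (Suc n)" using A v by simp
    from ex_GL_col_0[OF this v(2)] obtain P where P: "P \<in> GL (Suc n)" "col P 0 = v + A *\<^sub>v v" by auto
    obtain Q where Q: "Q \<in> GL (Suc n)" "Q * P = 1\<^sub>m (Suc n)" "P * Q = 1\<^sub>m (Suc n)"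
      using GL_inverse[OF P(1)] .
    have c: "P \<in> carrier_mat (Suc n) (Suc n)" "Q \<in> carrier_mat (Suc n) (Suc n)"
      using P Q by (auto simp: GL_iff_det)
    note as = assoc_mult_mat[of _ "Suc n" "Suc n" _ "Suc n" _ "Suc n"]
    define M where "M = Q * A * P"
    have M: "M \<in> carrier_mat (Suc n) (Suc n)" using c A by (simp add: M_def)
    have "P * M * Q = (P * Q) * A * (P * Q)" unfolding M_def using c A by (simp add: as)
    then have sim: "similar_mat A M"
      using A M c Q by (intro similar_matI[of _ _ P Q "Suc n"]) auto
    have "M * M = Q * (A * ((P * Q) * A)) * P" unfolding M_def using c A by (simp add: as)
    then have MM: "M * M = 1\<^sub>m (Suc n)" using Suc.prems Q c A by simp
    have "col M 0 = Q *\<^sub>v (A *\<^sub>v col P 0)" unfolding M_def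
      using c A by (simp add: as col_mat_mult[of _ "Suc n" "Suc n" _ "Suc n"])
    also have "\<dots> = col (Q * P) 0" 
      using c A by (simp add: P fix_v flip: col_mat_mult[of _ "Suc n" "Suc n" _ "Suc n"])
    finally have "col M 0 = unit_vec (Suc n) 0" unfolding Q by simp
    moreover have "M \<in> GL (Suc n)" using M MM det_mult[OF M M] by (auto simp: GL_iff_det)
    ultimately have "M \<in> {A \<in> GL (Suc n). col A 0 = unit_vec (Suc n) 0}" by simp
    then obtain w B where w: "w \<in> carrier_mat 1 n" and B: "B \<in> GL n"
      and M_eq: "M = four_block_mat (1\<^sub>m 1) w (0\<^sub>m n 1) B"
      unfolding GL_col_0_unit by (elim imageE SigmaE) (simp only: case_prod_conv)
    have Bc: "B \<in> carrier_mat n n" using B by (auto simp: GL_iff_det)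
    \<comment> \<open>The block form of \<open>M * M = 1\<close> yields both the condition on
      \<open>w\<close> that allows it to be removed and the fact that \<open>B\<close> is again an
      involution.\<close>
    have "four_block_mat (1\<^sub>m 1) (w + w * B) (0\<^sub>m n 1) (B * B)
        = four_block_mat (1\<^sub>m 1) (0\<^sub>m 1 n) (0\<^sub>m n 1) (1\<^sub>m n)"
      using MM unfolding M_eq using w Bc
      by (subst (asm) mult_four_block_mat[of _ 1 1 _ n _ n _ _ 1 _ n]) auto
    from four_block_mat_inject[OF this, of 1 1 n n] w Bc
    have wB: "w + w * B = 0\<^sub>m 1 n" and BB: "B * B = 1\<^sub>m n" by auto
    from Suc.IH[OF Bc BB] obtain k where k: "k \<le> n" "similar_mat B (signature_mat k (n - k))" by auto
    have "similar_mat M (four_block_mat (1\<^sub>m 1) (0\<^sub>m 1 n) (0\<^sub>m n 1) B)"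
      unfolding M_eq by (rule similar_mat_involution_four_block[OF two w Bc wB])
    moreover have "similar_mat (four_block_mat (1\<^sub>m 1) (0\<^sub>m 1 n) (0\<^sub>m n 1) B) (signature_mat (Suc k) (n - k))"
      using similar_mat_four_block_0_0[OF similar_mat_refl[of "1\<^sub>m 1" 1] k(2) _ Bc] k(1)
      by (simp add: signature_mat_Suc)
    ultimately show ?thesis using sim k(1)
      by (intro exI[of _ "Suc k"]) (auto intro: similar_mat_trans)
  qed
qed

lemma char_poly_signature_mat:
  "char_poly (signature_mat k l :: 'a::field mat) = [:- 1, 1:] ^ k * [:1, 1:] ^ l"
proof -
  have "diag_mat (signature_mat k l :: 'a mat) = replicate k 1 @ replicate l (- 1)"
    by (rule nth_equalityI) (auto simp: diag_mat_def signature_mat_def nth_append)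
  moreover have "upper_triangular (signature_mat k l :: 'a mat)"
    unfolding signature_mat_def by (rule upper_triangular_four_block[of _ k _ l]) auto
  ultimately show ?thesis
    by (subst char_poly_upper_triangular[OF signature_mat_carrier]) auto
qed

text \<open>The multiplicity of \<open>1\<close> as a root of the characteristic polynomial is a
  similarity invariant, and it is \<open>k\<close> because \<open>-1\<close> differs from
  \<open>1\<close>.\<close>

lemma similar_signature_mat_imp_eq:
  assumes two: "(2 :: 'a::field) \<noteq> 0"
    and "similar_mat (signature_mat k l) (signature_mat k' l' :: 'a mat)"
  shows "k = k'"
proof -
  have ord: "Polynomial.order (1 :: 'a) ([:- 1, 1:] ^ k * [:1, 1:] ^ l) = k" for k l
  proof -
    have "Polynomial.order (1 :: 'a) ([:1, 1:] ^ l) = 0"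
      using two by (intro order_0I) auto
    then show ?thesis using order_power_n_n[of "1 :: 'a" k] by (subst order_mult) auto
  qed
  show ?thesis using char_poly_similar[OF assms(2)] ord unfolding char_poly_signature_mat by metis
qed

text \<open>The involutions are the disjoint union over \<open>k\<close> of the similarity classes
  of the signature matrices, and orbit-stabiliser gives the size of each class.\<close>

lemma i_GL_eq_sum:
  assumes two: "(2 :: 'a::{field,finite}) \<noteq> 0"
  shows "real (i_GL TYPE('a) n) = (\<Sum>k\<le>n. real (card (GL n :: 'a mat set)) /
    (real (card (GL k :: 'a mat set)) * real (card (GL (n - k) :: 'a mat set))))"
proof -
  let ?C = "\<lambda>k. {A. similar_mat A (signature_mat k (n - k) :: 'a mat)}"
  have eq: "involutions_GL n = (\<Union>k\<le>n. ?C k)"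
  proof (intro equalityI subsetI)
    fix A :: "'a mat" assume "A \<in> involutions_GL n"
    then show "A \<in> (\<Union>k\<le>n. ?C k)" 
      using involution_similar_signature[OF two, of A n]
      unfolding involutions_GL_def by (auto simp: GL_iff_det)
  next
    fix A :: "'a mat" assume "A \<in> (\<Union>k\<le>n. ?C k)"
    then obtain k where k: "k \<le> n" "similar_mat A (signature_mat k (n - k))" by auto
    then obtain P Q where "similar_mat_wit (signature_mat k (n - k)) A P Q"
      using similar_mat_sym unfolding similar_mat_def by blast
    moreover have D: "(signature_mat k (n - k) :: 'a mat) \<in> carrier_mat n n"
      using signature_mat_carrier[of k "n - k"] k by simp
    ultimately have w: "A \<in> carrier_mat n n" "P \<in> carrier_mat n n" "Q \<in> carrier_mat n n"
      "signature_mat k (n - k) = P * A * Q" "P * Q = 1\<^sub>m n" "Q * P = 1\<^sub>m n"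
      using similar_mat_witD2[of "signature_mat k (n - k)" n n A P Q] by auto
    have "A * A = Q * (signature_mat k (n - k) * signature_mat k (n - k)) * P"
    proof -
      have "Q * (signature_mat k (n - k) * signature_mat k (n - k)) * P
          = Q * P * (A * ((Q * P) * (A * (Q * P))))"
        unfolding w(4) using w(1-3) by (simp add: assoc_mult_mat[of _ n n _ n _ n])
      then show ?thesis using w by simp
    qed
    moreover have "signature_mat k (n - k) * signature_mat k (n - k) = (1\<^sub>m n :: 'a mat)"
      using k(1) by (simp add: signature_mat_square)
    ultimately have "A * A = Q * 1\<^sub>m n * P" by (simp only:)
    then have AA: "A * A = 1\<^sub>m n" using w(2,3,6) by simp
    then have "A \<in> GL n" using w det_mult[of A n A] by (auto simp: GL_iff_det)
    with AA show "A \<in> involutions_GL n" unfolding involutions_GL_def by auto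
  qed
  have "card (involutions_GL n :: 'a mat set) = (\<Sum>k\<le>n. card (?C k))"
    unfolding eq
  proof (rule card_UN_disjoint)
    show "\<forall>k\<in>{..n}. finite (?C k)"
    proof
      fix k assume "k \<in> {..n}"
      then have "?C k \<subseteq> carrier_mat n n"
        using similar_mat_iff_GL[of "signature_mat k (n - k)" n] signature_mat_carrier[of k "n - k"] by auto
      then show "finite (?C k)" by (rule finite_subset[OF _ finite_carrier_mat])
    qed
    show "\<forall>k\<in>{..n}. \<forall>l\<in>{..n}. k \<noteq> l \<longrightarrow> ?C k \<inter> ?C l = {}"
      using similar_signature_mat_imp_eq[OF two] similar_mat_sym similar_mat_trans by blast
  qed auto
  also have "real \<dots> = (\<Sum>k\<le>n. real (card (GL n :: 'a mat set)) /
    (real (card (GL k :: 'a mat set)) * real (card (GL (n - k) :: 'a mat set))))"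
    unfolding of_nat_sum
  proof (rule sum.cong)
    fix k assume k: "k \<in> {..n}"
    have "1\<^sub>m m \<in> (GL m :: 'a mat set)" for m by (simp add: GL_iff_det)
    then have "card (GL m :: 'a mat set) > 0" for m
      using finite_GL[of m] by (auto simp: card_gt_0_iff)
    then have "card (GL k :: 'a mat set) * card (GL (n - k) :: 'a mat set) > 0" by simp
    moreover have "card (GL n :: 'a mat set) = card (?C k) * (card (GL k :: 'a mat set) * card (GL (n - k) :: 'a mat set))"
      using card_similarity_class[OF signature_mat_carrier[of k "n - k", where 'a = 'a]]
        card_centralizer_signature_mat[OF two, of k "n - k"] k by simp
    ultimately show "real (card (?C k)) = real (card (GL n :: 'a mat set)) /
      (real (card (GL k :: 'a mat set)) * real (card (GL (n - k) :: 'a mat set)))" 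
      by (simp add: field_simps flip: of_nat_mult)
  qed simp
  finally show ?thesis unfolding i_GL_def .
qed

section \<open>Gaussian binomials and the Jacobi triple product\<close>

definition qpoch :: "real \<Rightarrow> nat \<Rightarrow> real" where
  "qpoch y n = (\<Prod>i<n. 1 - y ^ Suc i)"

text \<open>The value \<open>0\<close> for \<open>k > n\<close> lets the Pascal rule hold up to
  \<open>k = n\<close>.\<close>

definition qbinom :: "real \<Rightarrow> nat \<Rightarrow> nat \<Rightarrow> real" where
  "qbinom y n k = (if k \<le> n then qpoch y n / (qpoch y k * qpoch y (n - k)) else 0)"

text \<open>Euler's infinite product, not the totient function.\<close>

definition euler_phi :: "real \<Rightarrow> real" where
  "euler_phi y = (\<Prod>i. 1 - y ^ Suc i)"

lemma qpoch_0 [simp]: "qpoch y 0 = 1"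
  by (simp add: qpoch_def)

lemma qpoch_Suc: "qpoch y (Suc n) = qpoch y n * (1 - y ^ Suc n)"
  by (simp add: qpoch_def)

lemma one_minus_power_pos: "0 < y \<Longrightarrow> y < 1 \<Longrightarrow> 0 < 1 - (y::real) ^ Suc i"
  using power_Suc_less_one[of y i] by simp

lemma qpoch_pos: "0 < y \<Longrightarrow> y < 1 \<Longrightarrow> 0 < qpoch y n"
  unfolding qpoch_def by (intro prod_pos ballI one_minus_power_pos) 

lemma qpoch_le_1:
  assumes "0 < y" "y < 1"
  shows "qpoch y n \<le> 1"
  unfolding qpoch_def
proof (rule prod_le_1)
  fix i
  show "0 \<le> 1 - y ^ Suc i \<and> 1 - y ^ Suc i \<le> 1"
    using one_minus_power_pos[OF assms, of i] assms by simp
qed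

lemma summable_power_mult_Suc:
  assumes "0 < (y::real)" "y < 1" "0 < m"
  shows "summable (\<lambda>i. y ^ (m * i + l))"
proof -
  have "y ^ m < 1" using assms by (metis power_Suc_less_one gr0_conv_Suc)
  then have "summable (\<lambda>i. y ^ l * (y ^ m) ^ i)"
    using assms by (intro summable_mult summable_geometric) auto
  then show ?thesis by (simp only: power_add power_mult mult.commute[of _ "y ^ l"])
qed

text \<open>The third premise says that all terms have a common sign. Summability is then absolute,
  which makes the product converge, and a convergent product without zero factors is
  nonzero.\<close>

lemma prod_LIMSEQ_prodinf:
  fixes a :: "nat \<Rightarrow> real"
  assumes "summable a" "\<And>i. a i \<noteq> - 1" "\<And>i. 0 \<le> a i \<or> (\<forall>i. a i \<le> 0)"
  shows "(\<lambda>n. \<Prod>i<n. 1 + a i) \<longlonglongrightarrow> (\<Prod>i. 1 + a i)" "(\<Prod>i. 1 + a i) \<noteq> 0" "convergent_prod (\<lambda>i. 1 + a i)"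
proof -
  have "summable (\<lambda>i. \<bar>a i\<bar>)"
  proof (cases "\<forall>i. a i \<le> 0")
    case True
    then have "(\<lambda>i. \<bar>a i\<bar>) = (\<lambda>i. - a i)" by auto
    then show ?thesis using assms(1) by (simp add: summable_minus_iff)
  next
    case False
    with assms(3) have "(\<lambda>i. \<bar>a i\<bar>) = a" by (auto simp: fun_eq_iff)
    then show ?thesis using assms(1) by simp
  qed
  then show c: "convergent_prod (\<lambda>i. 1 + a i)"
    by (intro abs_convergent_prod_imp_convergent_prod summable_imp_abs_convergent_prod) simp
  show "(\<lambda>n. \<Prod>i<n. 1 + a i) \<longlonglongrightarrow> (\<Prod>i. 1 + a i)"
    using convergent_prod_LIMSEQ[OF c] by (simp add: LIMSEQ_lessThan_iff_atMost[of "prod (\<lambda>i. 1 + a i)"])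
  show "(\<Prod>i. 1 + a i) \<noteq> 0"
    using assms(2) by (intro prodinf_nonzero c) (auto simp: add_eq_0_iff)
qed

text \<open>Positivity of the limit combines two facts: a limit of positive numbers is nonnegative,
  and a convergent product without zero factors is nonzero.\<close>

lemma qpoch_LIMSEQ:
  assumes "0 < y" "y < 1"
  shows "qpoch y \<longlonglongrightarrow> euler_phi y" and euler_phi_pos: "0 < euler_phi y"
proof -
  note p = prod_LIMSEQ_prodinf[of "\<lambda>i. - (y ^ Suc i)"]
  have s: "summable (\<lambda>i. - (y ^ Suc i))"
    using summable_power_mult_Suc[OF assms, of 1 1] by (simp add: summable_minus_iff)
  have n: "- (y ^ Suc i) \<noteq> - 1" for i using one_minus_power_pos[OF assms, of i] by auto
  have l: "\<And>i. - (y ^ Suc i) \<le> 0" using assms by simp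
  show lim: "qpoch y \<longlonglongrightarrow> euler_phi y"
    unfolding qpoch_def euler_phi_def using p(1)[OF s n] l by simp
  have "euler_phi y \<ge> 0"
    by (rule LIMSEQ_le_const[OF lim]) (use qpoch_pos[OF assms] less_imp_le in blast)
  moreover have "euler_phi y \<noteq> 0" 
    unfolding euler_phi_def using p(2)[OF s n] l by simp
  ultimately show "0 < euler_phi y" by simp
qed

lemma euler_phi_le_qpoch:
  assumes "0 < y" "y < 1"
  shows "euler_phi y \<le> qpoch y n"
proof (rule decseq_ge[OF _ qpoch_LIMSEQ(1)[OF assms]])
  show "decseq (qpoch y)"
  proof (rule decseq_SucI)
    fix n show "qpoch y (Suc n) \<le> qpoch y n"
      using qpoch_pos[OF assms, of n] assms by (simp add: qpoch_Suc mult_left_le)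
  qed
qed

lemma qbinom_nonneg: "0 < y \<Longrightarrow> y < 1 \<Longrightarrow> 0 \<le> qbinom y n k"
  unfolding qbinom_def using qpoch_pos[of y] by (simp add: less_imp_le)

text \<open>The numerator is at most \<open>1\<close> and each factor of the denominator is at least
  \<open>euler_phi y\<close>. The bound is uniform in \<open>n\<close> and \<open>k\<close>, as
  dominated convergence requires.\<close>

lemma qbinom_le:
  assumes "0 < y" "y < 1"
  shows "qbinom y n k \<le> 1 / (euler_phi y)\<^sup>2"
proof -
  note [simp] = euler_phi_pos[OF assms] qpoch_pos[OF assms] 
  have "qpoch y n / (qpoch y k * qpoch y (n - k)) \<le> 1 / (euler_phi y)\<^sup>2"
    unfolding power2_eq_square
    by (intro frac_le mult_mono euler_phi_le_qpoch assms qpoch_le_1) (auto intro: less_imp_le)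
  then show ?thesis by (simp add: qbinom_def)
qed

lemma qbinom_0 [simp]: "0 < y \<Longrightarrow> y < 1 \<Longrightarrow> qbinom y n 0 = 1"
  using qpoch_pos[of y n] by (simp add: qbinom_def)

text \<open>With \<open>d = n - k - 1\<close>, splitting the last factor of the numerator as
  \<open>1 - y^(n+1) = (1 - y^(d+1)) + y^(d+1) (1 - y^(k+1))\<close> gives the two terms; for
  \<open>k = n\<close> the first one is the default value \<open>0\<close>.\<close>

lemma qbinom_Suc_Suc:
  assumes "0 < y" "y < 1" "k \<le> n"
  shows "qbinom y (Suc n) (Suc k) = qbinom y n (Suc k) + y ^ (n - k) * qbinom y n k"
proof (cases "k = n")
  case True
  then show ?thesis using qpoch_pos[OF assms(1,2), of "Suc n"] qpoch_pos[OF assms(1,2), of n]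
    by (simp add: qbinom_def)
next
  case False
  with assms(3) obtain d where n: "n = Suc (k + d)" by (metis add_Suc_right less_imp_Suc_add le_neq_implies_less)
  define a b c where "a = qpoch y k" and "b = qpoch y d" and "c = qpoch y n"
  have pos: "a > 0" "b > 0" "c > 0" "1 - y ^ Suc k > 0" "1 - y ^ Suc d > 0"
    unfolding a_def b_def c_def by (simp_all only: qpoch_pos[OF assms(1,2)] one_minus_power_pos[OF assms(1,2)])
  have "1 - y ^ Suc n = (1 - y ^ Suc d) + y ^ Suc d * (1 - y ^ Suc k)"
    unfolding n by (simp add: algebra_simps power_add)
  moreover have "c * (u + p * v) / ((a * v) * (b * u)) = c / ((a * v) * b) + p * (c / (a * (b * u)))"
    if "u > 0" "v > 0" for p u v
    using that pos by (simp add: divide_simps) (simp add: algebra_simps)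
  ultimately have "c * (1 - y ^ Suc n) / ((a * (1 - y ^ Suc k)) * (b * (1 - y ^ Suc d)))
    = c / ((a * (1 - y ^ Suc k)) * b) + y ^ Suc d * (c / (a * (b * (1 - y ^ Suc d))))"
    using pos by (simp only:)
  then show ?thesis
    by (simp add: qbinom_def n flip: a_def b_def c_def) (simp add: qpoch_Suc n a_def b_def c_def)
qed

section \<open>The q-binomial theorem and a finite triple product\<close>

lemma q_binomial:
  assumes "0 < y" "y < 1"
  shows "(\<Prod>i<n. 1 + y ^ i * t) = (\<Sum>k\<le>n. qbinom y n k * y ^ (k choose 2) * t ^ k)"
proof (induction n)
  case 0
  show ?case using assms by (simp add: numeral_2_eq_2)
next
  case (Suc n)
  have [simp]: "(0 choose 2) = 0" by (simp add: numeral_2_eq_2)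
  let ?c = "\<lambda>n k. qbinom y n k * y ^ (k choose 2) * t ^ k"
  have "(\<Sum>k\<le>Suc n. ?c (Suc n) k) = 1 + (\<Sum>k\<le>n. ?c (Suc n) (Suc k))"
    using assms by (subst sum.atMost_Suc_shift) simp
  also have "(\<Sum>k\<le>n. ?c (Suc n) (Suc k)) = (\<Sum>k\<le>n. ?c n (Suc k) + y ^ n * t * ?c n k)"
  proof (rule sum.cong)
    fix k assume "k \<in> {..n}"
    then have k: "k \<le> n" by simp
    \<comment> \<open>The additional \<open>k\<close> in the triangular exponent turns
      \<open>y^(n-k)\<close> from the Pascal rule into \<open>y^n\<close>, which is the same for
      every \<open>k\<close> and so factors out of the sum.\<close>
    have "(Suc k choose 2) = k + (k choose 2)" by (simp add: numeral_2_eq_2)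
    moreover have "y ^ (n - k) * y ^ k = y ^ n" using k by (simp flip: power_add)
    ultimately show "?c (Suc n) (Suc k) = ?c n (Suc k) + y ^ n * t * ?c n k"
      using qbinom_Suc_Suc[OF assms k] by (simp add: power_add algebra_simps)
  qed simp
  also have "\<dots> = (\<Sum>k\<le>n. ?c n (Suc k)) + y ^ n * t * (\<Sum>k\<le>n. ?c n k)"
    by (simp add: sum.distrib sum_distrib_left)
  also have "1 + ((\<Sum>k\<le>n. ?c n (Suc k)) + y ^ n * t * (\<Sum>k\<le>n. ?c n k))
    = (\<Sum>k\<le>Suc n. ?c n k) + y ^ n * t * (\<Sum>k\<le>n. ?c n k)"
    using assms by (subst sum.atMost_Suc_shift) simp
  also have "(\<Sum>k\<le>Suc n. ?c n k) = (\<Sum>k\<le>n. ?c n k)" by (simp add: qbinom_def)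
  finally show ?case using Suc.IH by (simp add: algebra_simps)
qed

text \<open>The q-binomial theorem with base \<open>x^2\<close> and \<open>2m\<close> factors,
  recentred at \<open>k = m\<close>: the upper \<open>m\<close> factors contain \<open>z\<close>,
  and the lower \<open>m\<close> contain \<open>1 / z\<close> once a monomial is taken out.\<close>

lemma finite_jacobi_triple_product:
  assumes x: "0 < x" "x < 1" and z: "z \<noteq> (0::real)"
  shows "(\<Prod>i<m. (1 + x ^ (2 * i + 1) * z) * (1 + x ^ (2 * i + 1) / z))
    = (\<Sum>k\<le>2 * m. qbinom (x\<^sup>2) (2 * m) k * (x powi ((int k - int m)\<^sup>2) * z powi (int k - int m)))"
proof -
  \<comment> \<open>Chosen so that the factor with index \<open>m + i\<close> becomes
    \<open>1 + x^(2i+1) z\<close>.\<close>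
  define t where "t = z * x / x ^ (2 * m)"
  define L where "L = (\<Prod>i<m. 1 + x ^ (2 * i + 1) * z)"
  define R where "R = (\<Prod>i<m. 1 + x ^ (2 * i + 1) / z)"
  have y: "0 < x\<^sup>2" "x\<^sup>2 < 1" using x power_Suc_less_one[of x 1] by (auto simp: numeral_2_eq_2)
  have x0: "x \<noteq> 0" using x by simp
  have upper: "(\<Prod>i<m. 1 + (x\<^sup>2) ^ (m + i) * t) = (\<Prod>i<m. 1 + x ^ (2 * i + 1) * z)"
    using x0 by (intro prod.cong) (auto simp: t_def power_add simp flip: power_mult)
  have sum_odd: "(\<Sum>i<m. 2 * i + 1) = m\<^sup>2" for m :: nat
    by (induction m) (auto simp: power2_eq_square)
  \<comment> \<open>Read backwards, the lower factors are \<open>1 + z / x^(2i+1)\<close>; taking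
    out \<open>z / x^(2i+1)\<close> leaves the factors with \<open>1 / z\<close>, and the odd
    exponents sum to \<open>m^2\<close>.\<close>
  have "(\<Prod>i<m. 1 + (x\<^sup>2) ^ i * t) = (\<Prod>i<m. 1 + (x\<^sup>2) ^ (m - Suc i) * t)"
    by (rule prod.nat_diff_reindex[symmetric])
  also have "\<dots> = (\<Prod>i<m. (z / x ^ (2 * i + 1)) * (1 + x ^ (2 * i + 1) / z))"
  proof (rule prod.cong)
    fix i assume "i \<in> {..<m}"
    then have "2 * m = 2 * (m - Suc i) + 2 * i + 2" by simp
    then have e: "x ^ (2 * m) = (x\<^sup>2) ^ (m - Suc i) * (x ^ (2 * i + 1) * x)"
      by (metis add.assoc power_add power_mult power_one_right mult_2 one_add_one)
    have "(x\<^sup>2) ^ (m - Suc i) * t = z / x ^ (2 * i + 1)"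
      using x0 unfolding t_def e by (simp add: field_simps)
    then show "1 + (x\<^sup>2) ^ (m - Suc i) * t = (z / x ^ (2 * i + 1)) * (1 + x ^ (2 * i + 1) / z)"
      using x0 z by (simp add: distrib_left)
  qed simp
  also have "\<dots> = z ^ m / x ^ m\<^sup>2 * (\<Prod>i<m. 1 + x ^ (2 * i + 1) / z)"
    by (simp only: prod.distrib prod_dividef prod_constant card_lessThan power_sum[symmetric] sum_odd)
  finally have lower: "(\<Prod>i<m. 1 + (x\<^sup>2) ^ i * t) = z ^ m / x ^ m\<^sup>2 * (\<Prod>i<m. 1 + x ^ (2 * i + 1) / z)" .
  have "(\<Prod>i<2 * m. 1 + (x\<^sup>2) ^ i * t) = (\<Prod>i<m. 1 + (x\<^sup>2) ^ i * t) * (\<Prod>i<m. 1 + (x\<^sup>2) ^ (m + i) * t)"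
  proof -
    have U: "{..<2 * m} = {..<m} \<union> {m..<m + m}" by auto
    have "(\<Prod>i<2 * m. 1 + (x\<^sup>2) ^ i * t) = (\<Prod>i<m. 1 + (x\<^sup>2) ^ i * t) * (\<Prod>i\<in>{m..<m + m}. 1 + (x\<^sup>2) ^ i * t)"
      unfolding U by (rule prod.union_disjoint) auto
    also have "(\<Prod>i\<in>{m..<m + m}. 1 + (x\<^sup>2) ^ i * t) = (\<Prod>i<m. 1 + (x\<^sup>2) ^ (m + i) * t)"
      by (rule prod.reindex_bij_witness[of _ "\<lambda>i. m + i" "\<lambda>i. i - m"]) auto
    finally show ?thesis .
  qed
  then have split: "z ^ m / x ^ m\<^sup>2 * R * L = (\<Sum>k\<le>2 * m. qbinom (x\<^sup>2) (2 * m) k * (x\<^sup>2) ^ (k choose 2) * t ^ k)"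
    unfolding q_binomial[OF y, symmetric] upper lower L_def R_def by (simp only:)
  have "(\<Prod>i<m. (1 + x ^ (2 * i + 1) * z) * (1 + x ^ (2 * i + 1) / z)) = L * R"
    unfolding L_def R_def by (rule prod.distrib)
  also have "\<dots> = x ^ m\<^sup>2 / z ^ m * (z ^ m / x ^ m\<^sup>2 * R * L)" using x0 z by simp
  also have "\<dots> = x ^ m\<^sup>2 / z ^ m * (\<Sum>k\<le>2 * m. qbinom (x\<^sup>2) (2 * m) k * (x\<^sup>2) ^ (k choose 2) * t ^ k)"
    unfolding split ..
  also have "\<dots> = (\<Sum>k\<le>2 * m. qbinom (x\<^sup>2) (2 * m) k * (x powi ((int k - int m)\<^sup>2) * z powi (int k - int m)))"
    unfolding sum_distrib_left
  proof (rule sum.cong)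
    fix k
    \<comment> \<open>Twice the triangular number plus \<open>k\<close> is a square, so the exponent
      of \<open>x\<close> becomes \<open>k^2 + m^2 - 2mk\<close>.\<close>
    have c2: "2 * (k choose 2) + k = k\<^sup>2"
      by (induction k) (auto simp: numeral_2_eq_2)
    have "(x\<^sup>2) ^ (k choose 2) * t ^ k = x ^ (2 * (k choose 2) + k) * z ^ k / x ^ (2 * m * k)"
      by (simp add: t_def power_add power_mult_distrib power_divide power_mult)
    then have "x ^ m\<^sup>2 / z ^ m * ((x\<^sup>2) ^ (k choose 2) * t ^ k)
        = (x ^ k\<^sup>2 * x ^ m\<^sup>2 / x ^ (2 * m * k)) * (z ^ k / z ^ m)"
      unfolding c2 by (simp add: mult_ac)
    also have "z ^ k / z ^ m = z powi (int k - int m)"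
      using z by (simp add: power_int_diff)
    also have "x ^ k\<^sup>2 * x ^ m\<^sup>2 / x ^ (2 * m * k) = x powi ((int k - int m)\<^sup>2)"
    proof -
      have "(int k - int m)\<^sup>2 = int (k\<^sup>2) + int (m\<^sup>2) - int (2 * m * k)"
        by (simp add: power2_eq_square algebra_simps)
      then show ?thesis
        by (simp only: power_int_diff[OF disjI1[OF x0]] power_int_add[OF disjI1[OF x0]] power_int_of_nat)
    qed
    finally have "x ^ m\<^sup>2 / z ^ m * ((x\<^sup>2) ^ (k choose 2) * t ^ k)
        = x powi ((int k - int m)\<^sup>2) * z powi (int k - int m)" by (simp only: mult.commute)
    then have "qbinom (x\<^sup>2) (2 * m) k * (x ^ m\<^sup>2 / z ^ m * ((x\<^sup>2) ^ (k choose 2) * t ^ k))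
      = qbinom (x\<^sup>2) (2 * m) k * (x powi ((int k - int m)\<^sup>2) * z powi (int k - int m))" by (simp only:)
    then show "x ^ m\<^sup>2 / z ^ m * (qbinom (x\<^sup>2) (2 * m) k * (x\<^sup>2) ^ (k choose 2) * t ^ k)
      = qbinom (x\<^sup>2) (2 * m) k * (x powi ((int k - int m)\<^sup>2) * z powi (int k - int m))"
      by (simp add: mult_ac)
  qed simp
  finally show ?thesis .
qed

section \<open>Dominated convergence and the Jacobi triple product\<close>

lemma tannery_int:
  fixes f :: "nat \<Rightarrow> int \<Rightarrow> real"
  assumes lim: "\<And>j. (\<lambda>m. f m j) \<longlonglongrightarrow> g j" and bd: "\<And>m j. \<bar>f m j\<bar> \<le> M j" and "M summable_on UNIV"
  shows "(\<lambda>m. \<Sum>\<^sub>\<infinity>j. f m j) \<longlonglongrightarrow> (\<Sum>\<^sub>\<infinity>j. g j)"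
proof -
  \<comment> \<open>Enumerating the integers turns the unordered sums into ordinary series, where
    Tannery's theorem applies; the bound \<open>M\<close> supplies the absolute convergence that
    this passage needs.\<close>
  have bij: "bij_betw int_decode UNIV UNIV" by (rule bij_int_decode)
  have MS: "(\<lambda>n. M (int_decode n)) summable_on UNIV"
    using assms(3) summable_on_reindex_bij_betw[OF bij, of M] by simp
  then have Ms: "summable (\<lambda>n. M (int_decode n))"
    by (rule summable_on_imp_summable)
  have inf_eq: "(\<Sum>\<^sub>\<infinity>j. h j) = (\<Sum>n. h (int_decode n))" if "\<And>j. \<bar>h j\<bar> \<le> M j" for h :: "int \<Rightarrow> real"
  proof -
    have s: "summable (\<lambda>n. norm (h (int_decode n)))"
      by (rule summable_comparison_test'[OF Ms]) (use that in auto)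
    have "((\<lambda>n. h (int_decode n)) has_sum (\<Sum>n. h (int_decode n))) UNIV"
      by (rule norm_summable_imp_has_sum[OF s summable_sums[OF summable_norm_cancel[OF s]]])
    then show ?thesis
      using infsum_reindex_bij_betw[OF bij, of h] by (simp add: infsumI)
  qed
  have g: "\<bar>g j\<bar> \<le> M j" for j
    by (rule LIMSEQ_le_const2[OF tendsto_rabs[OF lim]]) (use bd in auto)
  have "(\<lambda>m. \<Sum>n. f m (int_decode n)) \<longlonglongrightarrow> (\<Sum>n. g (int_decode n))"
    using tannerys_theorem[of "\<lambda>n m. f m (int_decode n)" "\<lambda>n. g (int_decode n)" sequentially "\<lambda>n. M (int_decode n)"]
      lim bd Ms by (auto simp: case_prod_unfold)
  then show ?thesis by (simp add: inf_eq[OF g] inf_eq[OF bd])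
qed

text \<open>For fixed \<open>j = k - m\<close> all three Pochhammer products in the coefficient tend
  to \<open>euler_phi y\<close>, so the coefficient tends to \<open>1 / euler_phi y\<close>, and the
  uniform bound on Gaussian binomials dominates the sum. The offset \<open>e\<close> is taken as
  \<open>0\<close> for even and \<open>1\<close> for odd matrix size.\<close>

lemma qbinom_sum_LIMSEQ:
  assumes y: "0 < y" "y < 1" and w: "w summable_on (UNIV :: int set)"
  shows "(\<lambda>m. \<Sum>k\<le>2 * m + e. qbinom y (2 * m + e) k * w (int k - int m)) \<longlonglongrightarrow> (\<Sum>\<^sub>\<infinity>j. w j) / euler_phi y"
proof -
  \<comment> \<open>Extension by zero to all integers makes the index range independent of
    \<open>m\<close>.\<close>
  define f where "f m j = (if - int m \<le> j \<and> j \<le> int m + int e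
    then qbinom y (2 * m + e) (nat (int m + j)) * w j else 0)" for m j
  have fsum: "(\<Sum>\<^sub>\<infinity>j. f m j) = (\<Sum>k\<le>2 * m + e. qbinom y (2 * m + e) k * w (int k - int m))" for m
  proof -
    have "(\<Sum>\<^sub>\<infinity>j. f m j) = (\<Sum>\<^sub>\<infinity>j\<in>{- int m..int m + int e}. f m j)"
      by (rule infsum_cong_neutral) (auto simp: f_def)
    also have "\<dots> = (\<Sum>j\<in>{- int m..int m + int e}. f m j)" by simp
    also have "\<dots> = (\<Sum>k\<le>2 * m + e. qbinom y (2 * m + e) k * w (int k - int m))"
      by (rule sum.reindex_bij_witness[of _ "\<lambda>k. int k - int m" "\<lambda>j. nat (int m + j)"])
         (auto simp: f_def nat_le_iff)
    finally show ?thesis .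
  qed
  have lim: "(\<lambda>m. f m j) \<longlonglongrightarrow> w j / euler_phi y" for j
  proof -
    have a: "filterlim (\<lambda>m. 2 * m + e) at_top sequentially"
      "filterlim (\<lambda>m. nat (int m + j)) at_top sequentially"
      "filterlim (\<lambda>m. 2 * m + e - nat (int m + j)) at_top sequentially"
    proof -
      show "filterlim (\<lambda>m. 2 * m + e) at_top sequentially"
        by (rule filterlim_at_top_mono[OF filterlim_ident]) auto
      have "N \<le> nat (int m + j)" "N \<le> 2 * m + e - nat (int m + j)" if "m \<ge> N + nat \<bar>j\<bar>" for m N
        using that by linarith+
      then show "filterlim (\<lambda>m. nat (int m + j)) at_top sequentially"
        "filterlim (\<lambda>m. 2 * m + e - nat (int m + j)) at_top sequentially"
        unfolding filterlim_at_top eventually_sequentially by blast+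
    qed
    note q = filterlim_compose[OF qpoch_LIMSEQ(1)[OF y]]
    have "(\<lambda>m. qpoch y (2 * m + e) / (qpoch y (nat (int m + j)) * qpoch y (2 * m + e - nat (int m + j))) * w j)
      \<longlonglongrightarrow> euler_phi y / (euler_phi y * euler_phi y) * w j"
      using euler_phi_pos[OF y] by (intro tendsto_intros q a) auto
    moreover have "eventually (\<lambda>m. qpoch y (2 * m + e) / (qpoch y (nat (int m + j)) * qpoch y (2 * m + e - nat (int m + j))) * w j
      = f m j) sequentially"
      using eventually_ge_at_top[of "nat \<bar>j\<bar>"]
      by eventually_elim (auto simp: f_def qbinom_def)
    ultimately show ?thesis using euler_phi_pos[OF y] by (simp add: tendsto_cong)
  qed
  have "(\<lambda>m. \<Sum>\<^sub>\<infinity>j. f m j) \<longlonglongrightarrow> (\<Sum>\<^sub>\<infinity>j. w j / euler_phi y)"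
  proof (rule tannery_int[OF lim])
    show "\<bar>f m j\<bar> \<le> 1 / (euler_phi y)\<^sup>2 * \<bar>w j\<bar>" for m j
      using mult_right_mono[OF qbinom_le[OF y] abs_ge_zero, of "2 * m + e" "nat (int m + j)" "w j"]
        qbinom_nonneg[OF y] euler_phi_pos[OF y]
      by (auto simp: f_def abs_mult)
    show "(\<lambda>j. 1 / (euler_phi y)\<^sup>2 * \<bar>w j\<bar>) summable_on UNIV"
      using summable_on_iff_abs_summable_on_real[THEN iffD1, OF w]
      by (intro summable_on_cmult_right) simp
  qed
  moreover have "(\<Sum>\<^sub>\<infinity>j. w j / euler_phi y) = (\<Sum>\<^sub>\<infinity>j. w j) / euler_phi y"
    unfolding divide_inverse by (rule infsum_cmult_left')
  ultimately show ?thesis by (simp add: fsum)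
qed

text \<open>The quadratic exponent wins: \<open>x^(n^2) |z|^n = (x^n |z|)^n\<close> is eventually at
  most \<open>2^(-n)\<close>. Negative indices are the same case with \<open>1 / z\<close> in place
  of \<open>z\<close>.\<close>

lemma theta_summable:
  assumes x: "0 < x" "x < 1" and z: "z \<noteq> (0::real)"
  shows "(\<lambda>j. x powi (j\<^sup>2) * z powi j) summable_on UNIV"
proof -
  have nat_summable: "summable (\<lambda>n. norm (x ^ n\<^sup>2 * z ^ n))" for z
  proof (rule summable_comparison_test_ev)
    have "(\<lambda>n. norm (x ^ n * z)) \<longlonglongrightarrow> 0"
      using x by (intro tendsto_norm_zero tendsto_mult_left_zero LIMSEQ_power_zero) auto
    then have "eventually (\<lambda>n. norm (x ^ n * z) < 1 / 2) sequentially"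
      by (rule order_tendstoD) simp
    then show "eventually (\<lambda>n. norm (norm (x ^ n\<^sup>2 * z ^ n)) \<le> (1 / 2) ^ n) sequentially"
    proof eventually_elim
      case (elim n)
      have "norm (x ^ n\<^sup>2 * z ^ n) = norm (x ^ n * z) ^ n"
        by (simp add: power_mult_distrib power2_eq_square power_mult abs_mult power_abs)
      also have "\<dots> \<le> (1 / 2) ^ n" using elim by (intro power_mono) auto
      finally show ?case by simp
    qed
  qed (simp add: summable_geometric)
  let ?f = "\<lambda>j. x powi (j\<^sup>2) * z powi j"
  have sq: "x powi ((int n)\<^sup>2) = x ^ n\<^sup>2" for n
    by (simp add: power_int_def nat_power_eq)
  have "?f summable_on range int"
    using norm_summable_imp_summable_on[OF nat_summable[of z]]
    by (subst summable_on_reindex) (auto simp: o_def sq)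
  moreover have "?f summable_on range (\<lambda>n. - int n)"
    using norm_summable_imp_summable_on[OF nat_summable[of "1 / z"]]
    by (subst summable_on_reindex) (auto simp: o_def sq power_int_minus inj_on_def field_simps)
  moreover have "UNIV = range int \<union> range (\<lambda>n. - int n)"
    by (auto simp: image_iff) (metis int_cases2)
  ultimately show ?thesis by (metis summable_on_union)
qed

text \<open>The limit of the finite identity; the Gaussian binomials with base \<open>x^2\<close>
  supply the factor \<open>1 / euler_phi (x^2)\<close>.\<close>

lemma jacobi_triple_product:
  assumes x: "0 < x" "x < 1" and z: "z \<noteq> (0::real)"
  shows "(\<lambda>m. \<Prod>i<m. (1 + x ^ (2 * i + 1) * z) * (1 + x ^ (2 * i + 1) / z))
    \<longlonglongrightarrow> (\<Sum>\<^sub>\<infinity>j. x powi (j\<^sup>2) * z powi j) / euler_phi (x\<^sup>2)"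
proof -
  have "0 < x\<^sup>2" "x\<^sup>2 < 1" using x power_Suc_less_one[of x 1] by (auto simp: numeral_2_eq_2)
  from qbinom_sum_LIMSEQ[OF this theta_summable[OF assms], of 0]
  show ?thesis by (simp only: finite_jacobi_triple_product[OF assms] add_0_right)
qed

text \<open>Odd integers are written \<open>2i - 1\<close>, not \<open>2i + 1\<close>, so that their
  squares match the exponent in \<open>theta_odd\<close>.\<close>

lemma infsum_int_even_odd:
  fixes f :: "int \<Rightarrow> real"
  assumes "f summable_on UNIV"
  shows "(\<Sum>\<^sub>\<infinity>j. f j) = (\<Sum>\<^sub>\<infinity>i. f (2 * i)) + (\<Sum>\<^sub>\<infinity>i. f (2 * i - 1))"
proof -
  let ?E = "range (\<lambda>i::int. 2 * i)" and ?O = "range (\<lambda>i::int. 2 * i - 1)"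
  have U: "UNIV = ?E \<union> ?O"
  proof -
    have "j = 2 * (j div 2) \<or> j = 2 * (j div 2 + 1) - 1" for j :: int by presburger
    then show ?thesis by blast
  qed
  have s: "f summable_on ?E" "f summable_on ?O"
    using assms summable_on_subset_banach by blast+
  have "?E \<inter> ?O = {}" by (auto, presburger)
  from infsum_Un_disjoint[OF s this] show ?thesis unfolding U[symmetric]
    by (subst (asm) infsum_reindex, simp add: inj_on_def)
       (subst (asm) infsum_reindex, simp_all add: inj_on_def o_def)
qed

section \<open>The limits\<close>

text \<open>Partial products with a nonzero limit converge in the strict sense of infinite products,
  which is where the second premise enters.\<close>

lemma prodinf_eqI:
  fixes f :: "nat \<Rightarrow> real"
  assumes "(\<lambda>n. \<Prod>i<n. f i) \<longlonglongrightarrow> L" "L \<noteq> 0"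
  shows "prodinf f = L"
proof -
  have "f has_prod L"
    using assms LIMSEQ_lessThan_iff_atMost[of "prod f" L] by (simp add: has_prod_def raw_has_prod_def)
  then show ?thesis by (metis has_prod_unique)
qed

lemma tendsto_evensI:
  assumes "(\<lambda>m. f (2 * m)) \<longlonglongrightarrow> (L :: real)"
  shows "(f \<longlongrightarrow> L) evens"
  unfolding tendsto_def evens_def eventually_inf_principal eventually_sequentially
proof (intro allI impI)
  fix S assume "open S" "L \<in> S"
  with assms obtain N where N: "\<And>m. m \<ge> N \<Longrightarrow> f (2 * m) \<in> S"
    by (auto simp: tendsto_def eventually_sequentially)
  show "\<exists>N. \<forall>n\<ge>N. n \<in> {n. even n} \<longrightarrow> f n \<in> S"
    by (rule exI[of _ "2 * N"]) (auto elim!: evenE intro: N)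
qed

lemma tendsto_oddsI:
  assumes "(\<lambda>m. f (2 * m + 1)) \<longlonglongrightarrow> (L :: real)"
  shows "(f \<longlongrightarrow> L) odds"
  unfolding tendsto_def odds_def eventually_inf_principal eventually_sequentially
proof (intro allI impI)
  fix S assume "open S" "L \<in> S"
  with assms obtain N where N: "\<And>m. m \<ge> N \<Longrightarrow> f (2 * m + 1) \<in> S"
    by (auto simp: tendsto_def eventually_sequentially)
  show "\<exists>N. \<forall>n\<ge>N. n \<in> {n. odd n} \<longrightarrow> f n \<in> S"
    by (rule exI[of _ "2 * N"]) (auto elim!: oddE intro!: N[simplified])
qed

section \<open>The number of involutions as a centred sum of Gaussian binomials\<close>

lemma two_neq_zero_if_odd_card:
  assumes "odd CARD('a::{field,finite})"
  shows "(2 :: 'a) \<noteq> 0"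
proof
  assume "(2 :: 'a) = 0"
  then have "of_nat 2 = (0 :: 'a)" by simp
  then have "CHAR('a) dvd 2" by (simp only: of_nat_eq_0_iff_char_dvd)
  moreover have "CHAR('a) \<noteq> 1" by simp
  ultimately have "CHAR('a) = 2" using prime_nat_iff two_is_prime_nat by blast
  with assms CHAR_dvd_CARD[where 'a = 'a] show False by simp
qed

text \<open>Passing from \<open>n\<close> to \<open>n + 1\<close> multiplies the order by
  \<open>(q^(n+1) - 1) q^n = q^(2n+1) (1 - q^(-(n+1)))\<close>; the exponents \<open>2n + 1\<close>
  add up to a square and the remaining factors multiply to \<open>qpoch\<close>.\<close>

lemma card_GL:
  "real (card (GL n :: 'a::{field,finite} mat set)) = real CARD('a) ^ n\<^sup>2 * qpoch (1 / real CARD('a)) n"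
proof (induction n)
  case 0
  have "A = 1\<^sub>m 0" if "A \<in> carrier_mat 0 0" for A :: "'a mat" using that by (intro eq_matI) auto
  then have "(GL 0 :: 'a mat set) = {1\<^sub>m 0}" by (auto simp: GL_iff_det)
  then show ?case by simp
next
  case (Suc n)
  let ?q = "real CARD('a)"
  have "CARD('a) ^ Suc n \<ge> 1" by (simp add: Suc_leI)
  then have "real (CARD('a) ^ Suc n - 1) = ?q ^ Suc n - 1" by (simp add: of_nat_diff)
  then have "real (card (GL (Suc n) :: 'a mat set)) = (?q ^ Suc n - 1) * (?q ^ n * (?q ^ n\<^sup>2 * qpoch (1 / ?q) n))"
    unfolding card_GL_Suc Suc.IH[symmetric] by (simp only: of_nat_mult of_nat_power)
  also have "?q ^ Suc n - 1 = ?q ^ Suc n * (1 - (1 / ?q) ^ Suc n)"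
    by (simp add: field_simps)
  also have "\<dots> * (?q ^ n * (?q ^ n\<^sup>2 * qpoch (1 / ?q) n)) = ?q ^ (Suc n + n + n\<^sup>2) * qpoch (1 / ?q) (Suc n)"
    unfolding power_add qpoch_Suc by (simp only: mult_ac)
  also have "Suc n + n + n\<^sup>2 = (Suc n)\<^sup>2" by (simp add: power2_eq_square)
  finally show ?case .
qed

text \<open>The powers of \<open>q\<close> combine through
  \<open>n^2 - k^2 - (n-k)^2 = 2k(n-k)\<close>; integer exponents prepare the recentring of the
  sum.\<close>

lemma card_GL_ratio:
  assumes "k \<le> n"
  defines "q \<equiv> real CARD('a::{field,finite})"
  shows "real (card (GL n :: 'a mat set)) / (real (card (GL k :: 'a mat set)) * real (card (GL (n - k) :: 'a mat set)))
    = qbinom (1 / q) n k * q powi (2 * int k * (int n - int k))"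
proof -
  have q0: "q \<noteq> 0" by (simp add: q_def)
  have "2 * int k * (int n - int k) = int (n\<^sup>2) - int (k\<^sup>2) - int ((n - k)\<^sup>2)"
  proof -
    obtain d where "n = k + d" using assms(1) le_Suc_ex by blast
    then show ?thesis by (simp add: power2_eq_square algebra_simps)
  qed
  then have "q powi (2 * int k * (int n - int k)) = q ^ n\<^sup>2 / q ^ k\<^sup>2 / q ^ (n - k)\<^sup>2"
    by (simp only: power_int_diff[OF disjI1[OF q0]] power_int_of_nat)
  then show ?thesis using assms(1) by (simp add: card_GL qbinom_def mult_ac flip: q_def)
qed

lemma one_over_powi: "(1 / x :: real) powi n = x powi (- n)"
  by (simp add: power_int_minus power_int_inverse divide_inverse)

text \<open>With \<open>j = k - m\<close> the exponent of \<open>q\<close> is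
  \<open>2(m+j)(m-j) = 2m^2 - 2j^2\<close>.\<close>

lemma i_GL_even:
  assumes "(2 :: 'a::{field,finite}) \<noteq> 0"
  defines "q \<equiv> real CARD('a)"
  shows "real (i_GL TYPE('a) (2 * m)) / q ^ (2 * m\<^sup>2)
    = (\<Sum>k\<le>2 * m. qbinom (1 / q) (2 * m) k * (1 / q) powi (2 * (int k - int m)\<^sup>2))"
  unfolding i_GL_eq_sum[OF assms(1)] sum_divide_distrib
proof (rule sum.cong)
  fix k assume "k \<in> {..2 * m}"
  then have k: "k \<le> 2 * m" by simp
  have q0: "q \<noteq> 0" by (simp add: q_def)
  have "- (2 * (int k - int m)\<^sup>2) = 2 * int k * (int (2 * m) - int k) - int (2 * m\<^sup>2)"
    by (simp add: power2_eq_square algebra_simps)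
  then have "(1 / q) powi (2 * (int k - int m)\<^sup>2) = q powi (2 * int k * (int (2 * m) - int k)) / q ^ (2 * m\<^sup>2)"
    by (simp only: one_over_powi power_int_diff[OF disjI1[OF q0]] power_int_of_nat)
  then show "real (card (GL (2 * m) :: 'a mat set)) / (real (card (GL k :: 'a mat set)) * real (card (GL (2 * m - k) :: 'a mat set))) / q ^ (2 * m\<^sup>2)
    = qbinom (1 / q) (2 * m) k * (1 / q) powi (2 * (int k - int m)\<^sup>2)"
    using card_GL_ratio[OF k, where 'a = 'a] by (simp add: q_def)
qed simp

text \<open>With \<open>j = k - m\<close> the exponent of \<open>q\<close> is
  \<open>2(m+j)(m+1-j) = 2m^2 + 2m - (2j^2 - 2j)\<close>, symmetric about
  \<open>j = 1/2\<close>.\<close>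

lemma i_GL_odd:
  assumes "(2 :: 'a::{field,finite}) \<noteq> 0"
  defines "q \<equiv> real CARD('a)"
  shows "real (i_GL TYPE('a) (2 * m + 1)) / q ^ (2 * m\<^sup>2 + 2 * m)
    = (\<Sum>k\<le>2 * m + 1. qbinom (1 / q) (2 * m + 1) k * (1 / q) powi (2 * (int k - int m)\<^sup>2 - 2 * (int k - int m)))"
  unfolding i_GL_eq_sum[OF assms(1)] sum_divide_distrib
proof (rule sum.cong)
  fix k assume "k \<in> {..2 * m + 1}"
  then have k: "k \<le> 2 * m + 1" by simp
  have q0: "q \<noteq> 0" by (simp add: q_def)
  have "- (2 * (int k - int m)\<^sup>2 - 2 * (int k - int m)) = 2 * int k * (int (2 * m + 1) - int k) - int (2 * m\<^sup>2 + 2 * m)"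
    by (simp add: power2_eq_square algebra_simps)
  then have "(1 / q) powi (2 * (int k - int m)\<^sup>2 - 2 * (int k - int m))
      = q powi (2 * int k * (int (2 * m + 1) - int k)) / q ^ (2 * m\<^sup>2 + 2 * m)"
    by (simp only: one_over_powi power_int_diff[OF disjI1[OF q0]] power_int_of_nat)
  then show "real (card (GL (2 * m + 1) :: 'a mat set)) / (real (card (GL k :: 'a mat set)) * real (card (GL (2 * m + 1 - k) :: 'a mat set))) / q ^ (2 * m\<^sup>2 + 2 * m)
    = qbinom (1 / q) (2 * m + 1) k * (1 / q) powi (2 * (int k - int m)\<^sup>2 - 2 * (int k - int m))"
    using card_GL_ratio[OF k, where 'a = 'a] by (simp only: q_def times_divide_eq_right)
qed simp

section \<open>The two theta series and their product forms\<close>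

definition theta_even :: "real \<Rightarrow> real" where
  "theta_even u = (\<Sum>\<^sub>\<infinity>j. u powi (2 * j\<^sup>2))"

text \<open>Up to the factor \<open>u^(1/2)\<close>, this is the theta series with terms
  \<open>u^(2 r^2)\<close> over the half-integers \<open>r = j - 1/2\<close>.\<close>

definition theta_odd :: "real \<Rightarrow> real" where
  "theta_odd u = (\<Sum>\<^sub>\<infinity>j. u powi (2 * j\<^sup>2 - 2 * j))"

context
  fixes u :: real
  assumes u: "0 < u" "u < 1"
begin

lemma u_power: "0 < u\<^sup>2" "u\<^sup>2 < 1" "0 < u ^ 4" "u ^ 4 < 1"
  using u power_Suc_less_one[OF u, of 1] power_Suc_less_one[OF u, of 3]
  by (auto simp: numeral_2_eq_2 numeral_eq_Suc)

lemma theta_even_term: "(u\<^sup>2) powi (j\<^sup>2) * 1 powi j = u powi (2 * j\<^sup>2)"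
  by (simp add: power_int_power)

lemma theta_odd_term: "(u\<^sup>2) powi (j\<^sup>2) * (1 / u\<^sup>2) powi j = u powi (2 * j\<^sup>2 - 2 * j)"
  using u by (simp add: power_int_power power_int_inverse power_int_diff divide_inverse)

lemma theta_even_summable: "(\<lambda>j. u powi (2 * j\<^sup>2)) summable_on UNIV"
  using theta_summable[of "u\<^sup>2" 1] u_power unfolding theta_even_term by simp

lemma theta_odd_summable: "(\<lambda>j. u powi (2 * j\<^sup>2 - 2 * j)) summable_on UNIV"
  using theta_summable[of "u\<^sup>2" "1 / u\<^sup>2"] u_power u unfolding theta_odd_term by simp

text \<open>No term is negative and the one at \<open>j = 0\<close> is \<open>1\<close>. That the
  series do not vanish is used when limits of partial products are read as infinite
  products.\<close>

lemma theta_pos: "0 < theta_even u" "0 < theta_odd u"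
  using finite_sum_le_infsum[OF theta_even_summable, of "{0}"]
    finite_sum_le_infsum[OF theta_odd_summable, of "{0}"] u
  unfolding theta_even_def theta_odd_def by (simp_all add: zero_le_power_int)

text \<open>The triple product at \<open>x = u^2\<close> and \<open>z = 1\<close>, where the two
  factors coincide.\<close>

lemma theta_even_prod:
  "(\<lambda>m. \<Prod>i<m. (1 + u ^ (4 * i + 2))\<^sup>2) \<longlonglongrightarrow> theta_even u / euler_phi (u ^ 4)"
proof -
  have "(1 + (u\<^sup>2) ^ (2 * i + 1) * 1) * (1 + (u\<^sup>2) ^ (2 * i + 1) / 1) = (1 + u ^ (4 * i + 2))\<^sup>2" for i
  proof -
    have "2 * (2 * i + 1) = 4 * i + 2" by simp
    then have "(u\<^sup>2) ^ (2 * i + 1) = u ^ (4 * i + 2)" by (simp only: power_mult[symmetric])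
    then show ?thesis by (simp only: mult_1_right div_by_1) (simp only: power2_eq_square)
  qed
  moreover have "(u\<^sup>2)\<^sup>2 = u ^ 4" by simp
  ultimately show ?thesis
    using jacobi_triple_product[OF u_power(1,2), of 1]
    unfolding theta_even_term theta_even_def by (simp only: one_neq_zero not_False_eq_True simp_thms)
qed

text \<open>The triple product at \<open>x = u^2\<close> and \<open>z = u^(-2)\<close>, with factors
  \<open>1 + u^(4i)\<close> and \<open>1 + u^(4i+4)\<close>. Shifting the first family by one index
  gives squares, and its initial factor \<open>1 + 1\<close> is the \<open>2\<close> in the
  denominator.\<close>

lemma theta_odd_prod:
  "(\<lambda>m. \<Prod>i<m. (1 + u ^ (4 * Suc i))\<^sup>2) \<longlonglongrightarrow> theta_odd u / (2 * euler_phi (u ^ 4))"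
proof -
  let ?J = "\<lambda>m. \<Prod>i<m. (1 + (u\<^sup>2) ^ (2 * i + 1) * (1 / u\<^sup>2)) * (1 + (u\<^sup>2) ^ (2 * i + 1) / (1 / u\<^sup>2))"
  have u4: "(u\<^sup>2)\<^sup>2 = u ^ 4" by simp
  have lim: "?J \<longlonglongrightarrow> theta_odd u / euler_phi (u ^ 4)"
    using jacobi_triple_product[of "u\<^sup>2" "1 / u\<^sup>2"] u_power u
    unfolding theta_odd_term theta_odd_def u4 by simp
  \<comment> \<open>On partial products the shift trades the first factor \<open>2\<close> for a new
    last factor \<open>1 + u^(4m)\<close>, which tends to \<open>1\<close>.\<close>
  have J: "?J m * (1 + (u ^ 4) ^ m) / 2 = (\<Prod>i<m. (1 + u ^ (4 * Suc i))\<^sup>2)" for m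
  proof (induction m)
    case (Suc m)
    have "(u\<^sup>2) ^ (2 * m + 1) * (1 / u\<^sup>2) = (u ^ 4) ^ m" "(u\<^sup>2) ^ (2 * m + 1) / (1 / u\<^sup>2) = u ^ (4 * Suc m)"
    proof -
      have "2 * (2 * m + 1) = 4 * m + 2" "4 * m + 2 + 2 = 4 * Suc m" by simp_all
      then have "(u\<^sup>2) ^ (2 * m + 1) = (u ^ 4) ^ m * u\<^sup>2" "(u\<^sup>2) ^ (2 * m + 1) * u\<^sup>2 = u ^ (4 * Suc m)"
        by (simp_all only: power_mult[symmetric] power_add[symmetric])
      then show "(u\<^sup>2) ^ (2 * m + 1) * (1 / u\<^sup>2) = (u ^ 4) ^ m" "(u\<^sup>2) ^ (2 * m + 1) / (1 / u\<^sup>2) = u ^ (4 * Suc m)"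
        using u by simp_all
    qed
    then have "?J (Suc m) = ?J m * ((1 + (u ^ 4) ^ m) * (1 + u ^ (4 * Suc m)))"
      by simp
    then have "?J (Suc m) * (1 + (u ^ 4) ^ Suc m) / 2 = ?J m * (1 + (u ^ 4) ^ m) / 2 * (1 + u ^ (4 * Suc m))\<^sup>2"
      by (simp only: power_mult power2_eq_square) (simp add: field_simps)
    then show ?case unfolding Suc.IH by simp
  qed simp
  have "(\<lambda>m. ?J m * (1 + (u ^ 4) ^ m) / 2) \<longlonglongrightarrow> theta_odd u / euler_phi (u ^ 4) * (1 + 0) / 2"
    using u_power by (intro tendsto_intros lim LIMSEQ_power_zero) auto
  then show ?thesis unfolding J by (simp add: mult.commute)
qed

text \<open>Multiplying by the quotient of the Pochhammer products at \<open>u^4\<close> and at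
  \<open>u\<close> replaces \<open>euler_phi (u^4)\<close> in the denominator by
  \<open>euler_phi u\<close>.\<close>

lemma theta_even_prodinf:
  "(\<Prod>i. (1 + u ^ (4 * i + 2))\<^sup>2 * (1 - (u ^ 4) ^ Suc i) / (1 - u ^ Suc i)) = theta_even u / euler_phi u"
proof (rule prodinf_eqI)
  have "(\<lambda>m. (\<Prod>i<m. (1 + u ^ (4 * i + 2))\<^sup>2) * qpoch (u ^ 4) m / qpoch u m)
    \<longlonglongrightarrow> theta_even u / euler_phi (u ^ 4) * euler_phi (u ^ 4) / euler_phi u"
    using u u_power euler_phi_pos[OF u] by (intro tendsto_intros theta_even_prod qpoch_LIMSEQ) auto
  then show "(\<lambda>m. \<Prod>i<m. (1 + u ^ (4 * i + 2))\<^sup>2 * (1 - (u ^ 4) ^ Suc i) / (1 - u ^ Suc i))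
    \<longlonglongrightarrow> theta_even u / euler_phi u"
    using euler_phi_pos[of "u ^ 4"] u_power unfolding qpoch_def prod.distrib prod_dividef by simp
qed (use theta_pos euler_phi_pos[OF u] in auto)

lemma theta_odd_prodinf:
  "2 * (\<Prod>i. (1 + (u ^ 4) ^ Suc i) * (1 - (u ^ 8) ^ Suc i) / (1 - u ^ Suc i)) = theta_odd u / euler_phi u"
proof -
  have "(\<Prod>i. (1 + (u ^ 4) ^ Suc i) * (1 - (u ^ 8) ^ Suc i) / (1 - u ^ Suc i)) = theta_odd u / (2 * euler_phi u)"
  proof (rule prodinf_eqI)
    have "(\<lambda>m. (\<Prod>i<m. (1 + u ^ (4 * Suc i))\<^sup>2) * qpoch (u ^ 4) m / qpoch u m)
      \<longlonglongrightarrow> theta_odd u / (2 * euler_phi (u ^ 4)) * euler_phi (u ^ 4) / euler_phi u"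
      using u u_power euler_phi_pos[OF u] by (intro tendsto_intros theta_odd_prod qpoch_LIMSEQ) auto
    \<comment> \<open>With \<open>a = u^(4i+4)\<close> this is
      \<open>(1 + a) (1 - a^2) = (1 + a)^2 (1 - a)\<close>.\<close>
    moreover have "(1 + (u ^ 4) ^ Suc i) * (1 - (u ^ 8) ^ Suc i) = (1 + u ^ (4 * Suc i))\<^sup>2 * (1 - (u ^ 4) ^ Suc i)" for i
    proof -
      have "8 * Suc i = 4 * Suc i * 2" by simp
      then have "(u ^ 8) ^ Suc i = (u ^ (4 * Suc i))\<^sup>2" by (simp only: power_mult[symmetric])
      then show ?thesis unfolding power_mult by (simp only: power2_eq_square) (simp add: algebra_simps)
    qed
    ultimately show "(\<lambda>m. \<Prod>i<m. (1 + (u ^ 4) ^ Suc i) * (1 - (u ^ 8) ^ Suc i) / (1 - u ^ Suc i))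
      \<longlonglongrightarrow> theta_odd u / (2 * euler_phi u)"
      using euler_phi_pos[of "u ^ 4"] u_power unfolding qpoch_def by (simp only: prod.distrib prod_dividef) simp
  qed (use theta_pos euler_phi_pos[OF u] in auto)
  then show ?thesis by simp
qed

text \<open>The product with sign \<open>s\<close> is the two-sided theta series at nome \<open>sqrt u\<close>; the parity of
  its index separates \<open>theta_even\<close> from \<open>theta_odd\<close>.\<close>

lemma signed_prodinf:
  assumes s: "s = 1 \<or> s = (- 1 :: real)"
  shows "(\<Prod>i. (1 + s * sqrt u ^ (2 * i + 1))\<^sup>2) = (theta_even u + s * sqrt u * theta_odd u) / euler_phi u"
proof -
  let ?x = "sqrt u"
  have x: "0 < ?x" "?x < 1" "?x \<noteq> 0" "?x\<^sup>2 = u" using u by auto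
  let ?f = "\<lambda>j. ?x powi (j\<^sup>2) * s powi j"
  have ss: "s * s = 1" "s \<noteq> 0" "1 / s = s" "s\<^sup>2 = 1" using s by auto
  have sum: "?f summable_on UNIV" using theta_summable[OF x(1,2), of s] ss by simp
  have even: "?f (2 * i) = u powi (2 * i\<^sup>2)" for i
  proof -
    have "?x powi ((2 * i)\<^sup>2) = (?x ^ 2) powi (2 * i\<^sup>2)"
      unfolding power_int_power by (simp add: power2_eq_square mult_ac)
    moreover have "s powi (2 * i) = 1" unfolding power_int_mult using ss by simp
    ultimately show ?thesis using x by simp
  qed
  \<comment> \<open>Squares of odd numbers are odd, so one factor \<open>sqrt u\<close> is left over
    after rewriting in powers of \<open>u\<close>, and the sign survives as
    \<open>s\<close>.\<close>
  have odd: "?f (2 * i - 1) = s * ?x * u powi (2 * i\<^sup>2 - 2 * i)" for i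
  proof -
    have "(2 * i - 1)\<^sup>2 = 2 * (2 * i\<^sup>2 - 2 * i) + 1" by (simp add: power2_eq_square algebra_simps)
    then have "?x powi ((2 * i - 1)\<^sup>2) = (?x ^ 2) powi (2 * i\<^sup>2 - 2 * i) * ?x"
      unfolding power_int_power using x by (simp only: power_int_add[OF disjI1[OF x(3)]]) simp
    moreover have "s powi (2 * i - 1) = s"
      unfolding power_int_diff[OF disjI1[OF ss(2)]] power_int_mult using ss by simp
    ultimately show ?thesis using x by simp
  qed
  have S: "(\<Sum>\<^sub>\<infinity>j. ?f j) = theta_even u + s * ?x * theta_odd u"
    unfolding infsum_int_even_odd[OF sum] even odd theta_even_def theta_odd_def
    by (simp add: infsum_cmult_right')
  have "(\<lambda>m. \<Prod>i<m. (1 + s * ?x ^ (2 * i + 1))\<^sup>2) \<longlonglongrightarrow> (theta_even u + s * ?x * theta_odd u) / euler_phi u"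
  proof -
    \<comment> \<open>As \<open>1 / s = s\<close>, the two factors of the triple product
      agree.\<close>
    have "(1 + ?x ^ (2 * i + 1) * s) * (1 + ?x ^ (2 * i + 1) / s) = (1 + s * ?x ^ (2 * i + 1))\<^sup>2" for i
      using s by (auto simp: power2_eq_square)
    then show ?thesis using jacobi_triple_product[OF x(1,2) ss(2)] unfolding S x(4) by simp
  qed
  \<comment> \<open>Convergence of the infinite product is established on its own and the limits are
    then compared: for \<open>s = -1\<close> the theta expression is a difference that is not known
    in advance to be nonzero, so \<open>prodinf_eqI\<close> does not apply directly.\<close>
  moreover have "(\<Prod>i. (1 + s * ?x ^ (2 * i + 1))\<^sup>2) \<noteq> 0 \<and>
    (\<lambda>m. \<Prod>i<m. (1 + s * ?x ^ (2 * i + 1))\<^sup>2) \<longlonglongrightarrow> (\<Prod>i. (1 + s * ?x ^ (2 * i + 1))\<^sup>2)"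
  proof -
    have a: "summable (\<lambda>i. s * ?x ^ (2 * i + 1))"
      using summable_power_mult_Suc[OF x(1,2), of 2 1] by (intro summable_mult) simp
    have b: "s * ?x ^ (2 * i + 1) \<noteq> - 1" for i
      using s power_Suc_less_one[OF x(1,2), of "2 * i"] zero_less_power[OF x(1), of "2 * i + 1"] by auto
    have c: "0 \<le> s * ?x ^ (2 * i + 1) \<or> (\<forall>i. s * ?x ^ (2 * i + 1) \<le> 0)" for i
      using s x by auto
    note p = prod_LIMSEQ_prodinf[OF a b c]
    have "(\<Prod>i. (1 + s * ?x ^ (2 * i + 1))\<^sup>2) = (\<Prod>i. 1 + s * ?x ^ (2 * i + 1))\<^sup>2"
      by (rule prodinf_power[OF p(3)])
    then show ?thesis using p(2) tendsto_power[OF p(1), of 2] by (simp add: prod_power_distrib)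
  qed
  ultimately show ?thesis using LIMSEQ_unique by blast
qed

end

theorem theorem3p3:
  fixes q :: nat
  assumes "primepow q" and "odd q" and "CARD('a::{field, finite}) = q"
  shows
    "((\<lambda>n. real (i_GL TYPE('a) n) / real q powr ((real n)^2 / 2)) \<longlongrightarrow>
        1 / 2 * ((\<Prod>i. (1 + sqrt (real q) / real q ^ Suc i)^2)
               + (\<Prod>i. (1 - sqrt (real q) / real q ^ Suc i)^2))) evens
     \<and> 1 / 2 * ((\<Prod>i. (1 + sqrt (real q) / real q ^ Suc i)^2)
               + (\<Prod>i. (1 - sqrt (real q) / real q ^ Suc i)^2))
       = (\<Prod>i. (1 + real q powi (2 - 4 * int (Suc i)))^2 * (1 - real q powi (- 4 * int (Suc i)))
               / (1 - real q powi (- int (Suc i))))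
     \<and> ((\<lambda>n. real (i_GL TYPE('a) n) / real q powr (((real n)^2 - 1) / 2)) \<longlongrightarrow>
        sqrt (real q) / 2 * ((\<Prod>i. (1 + sqrt (real q) / real q ^ Suc i)^2)
                           - (\<Prod>i. (1 - sqrt (real q) / real q ^ Suc i)^2))) odds
     \<and> sqrt (real q) / 2 * ((\<Prod>i. (1 + sqrt (real q) / real q ^ Suc i)^2)
                           - (\<Prod>i. (1 - sqrt (real q) / real q ^ Suc i)^2))
       = 2 * (\<Prod>i. (1 + real q powi (- 4 * int (Suc i))) * (1 - real q powi (- 8 * int (Suc i)))
               / (1 - real q powi (- int (Suc i))))"
proof (intro conjI)
  define u where "u = 1 / real q"
  have q: "1 < q" using assms(1) by (rule primepow_gt_Suc_0[unfolded One_nat_def[symmetric]])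
  then have u: "0 < u" "u < 1" and q0: "real q \<noteq> 0" and qu: "real q = 1 / u" by (auto simp: u_def)
  have two: "(2 :: 'a) \<noteq> 0" using assms by (intro two_neq_zero_if_odd_card) simp
  \<comment> \<open>These are the half-integral powers \<open>u^(i + 1/2)\<close>, so both products
    are instances of \<open>signed_prodinf\<close>.\<close>
  have ratio: "sqrt (real q) / real q ^ Suc i = sqrt u ^ (2 * i + 1)" for i
  proof -
    have "sqrt u ^ (2 * i + 1) = u ^ i * sqrt u" using u by (simp add: power_mult)
    moreover have "sqrt (real q) / real q = sqrt u" using q by (simp add: u_def real_sqrt_divide divide_simps)
    moreover have "sqrt (real q) / real q ^ Suc i = u ^ i * (sqrt (real q) / real q)"
      by (simp add: u_def power_divide)
    ultimately show ?thesis by (simp only:)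
  qed
  have P: "(\<Prod>i. (1 + sqrt (real q) / real q ^ Suc i)\<^sup>2) = (theta_even u + sqrt u * theta_odd u) / euler_phi u"
    "(\<Prod>i. (1 - sqrt (real q) / real q ^ Suc i)\<^sup>2) = (theta_even u - sqrt u * theta_odd u) / euler_phi u"
    unfolding ratio using signed_prodinf[OF u, of 1] signed_prodinf[OF u, of "- 1"] by simp_all
  \<comment> \<open>In the difference of the two products \<open>theta_even\<close> cancels, and the
    prefactor \<open>sqrt q\<close> absorbs the \<open>sqrt u\<close> that accompanies
    \<open>theta_odd\<close>.\<close>
  have sq: "sqrt (real q) * sqrt u = 1" using q by (simp add: u_def real_sqrt_divide)
  have even: "1 / 2 * ((\<Prod>i. (1 + sqrt (real q) / real q ^ Suc i)\<^sup>2)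
      + (\<Prod>i. (1 - sqrt (real q) / real q ^ Suc i)\<^sup>2)) = theta_even u / euler_phi u"
    unfolding P by (simp flip: add_divide_distrib)
  have odd: "sqrt (real q) / 2 * ((\<Prod>i. (1 + sqrt (real q) / real q ^ Suc i)\<^sup>2)
      - (\<Prod>i. (1 - sqrt (real q) / real q ^ Suc i)\<^sup>2)) = theta_odd u / euler_phi u"
  proof -
    have "sqrt (real q) / 2 * ((theta_even u + sqrt u * theta_odd u) / euler_phi u
        - (theta_even u - sqrt u * theta_odd u) / euler_phi u)
      = (sqrt (real q) * sqrt u) * theta_odd u / euler_phi u"
      by (simp flip: diff_divide_distrib)
    then show ?thesis unfolding P sq by simp
  qed
  have powi: "real q powi - int n = u ^ n" for n
    by (simp add: u_def power_int_minus power_inverse divide_inverse)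
  show "1 / 2 * ((\<Prod>i. (1 + sqrt (real q) / real q ^ Suc i)^2)
      + (\<Prod>i. (1 - sqrt (real q) / real q ^ Suc i)^2))
    = (\<Prod>i. (1 + real q powi (2 - 4 * int (Suc i)))^2 * (1 - real q powi (- 4 * int (Suc i)))
      / (1 - real q powi (- int (Suc i))))"
  proof -
    \<comment> \<open>The products are indexed from \<open>0\<close>, so the exponent
      \<open>2 - 4(i+1)\<close> is \<open>-(4i+2)\<close>.\<close>
    have "2 - 4 * int (Suc i) = - int (4 * i + 2)" "- 4 * int (Suc i) = - int (4 * Suc i)" for i by simp_all
    then show ?thesis unfolding even theta_even_prodinf[OF u, symmetric] by (simp only: powi power_mult)
  qed
  show "sqrt (real q) / 2 * ((\<Prod>i. (1 + sqrt (real q) / real q ^ Suc i)^2)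
      - (\<Prod>i. (1 - sqrt (real q) / real q ^ Suc i)^2))
    = 2 * (\<Prod>i. (1 + real q powi (- 4 * int (Suc i))) * (1 - real q powi (- 8 * int (Suc i)))
      / (1 - real q powi (- int (Suc i))))"
  proof -
    have "- 4 * int (Suc i) = - int (4 * Suc i)" "- 8 * int (Suc i) = - int (8 * Suc i)" for i by simp_all
    then show ?thesis unfolding odd theta_odd_prodinf[OF u, symmetric] by (simp only: powi power_mult)
  qed
  show "((\<lambda>n. real (i_GL TYPE('a) n) / real q powr ((real n)^2 / 2)) \<longlongrightarrow>
    1 / 2 * ((\<Prod>i. (1 + sqrt (real q) / real q ^ Suc i)^2)
      + (\<Prod>i. (1 - sqrt (real q) / real q ^ Suc i)^2))) evens"
    unfolding even
  proof (rule tendsto_evensI)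
    \<comment> \<open>The exponent \<open>(2m)^2 / 2 = 2m^2\<close> is a natural number, so the real
      power is the normalisation used in \<open>i_GL_even\<close>.\<close>
    have "real q powr ((real (2 * m))\<^sup>2 / 2) = real q ^ (2 * m\<^sup>2)" for m
    proof -
      have "(real (2 * m))\<^sup>2 / 2 = real (2 * m\<^sup>2)" by (simp add: power2_eq_square)
      then show ?thesis using q by (simp only: powr_realpow of_nat_0_less_iff)
    qed
    then show "(\<lambda>m. real (i_GL TYPE('a) (2 * m)) / real q powr ((real (2 * m))\<^sup>2 / 2))
      \<longlonglongrightarrow> theta_even u / euler_phi u"
      using qbinom_sum_LIMSEQ[OF u theta_even_summable[OF u], of 0]
      unfolding theta_even_def by (simp only: i_GL_even[OF two, unfolded assms(3)] u_def add_0_right)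
  qed
  show "((\<lambda>n. real (i_GL TYPE('a) n) / real q powr (((real n)^2 - 1) / 2)) \<longlongrightarrow>
    sqrt (real q) / 2 * ((\<Prod>i. (1 + sqrt (real q) / real q ^ Suc i)^2)
      - (\<Prod>i. (1 - sqrt (real q) / real q ^ Suc i)^2))) odds"
    unfolding odd
  proof (rule tendsto_oddsI)
    \<comment> \<open>Likewise \<open>((2m+1)^2 - 1) / 2 = 2m^2 + 2m\<close>, the normalisation used
      in \<open>i_GL_odd\<close>.\<close>
    have "real q powr (((real (2 * m + 1))\<^sup>2 - 1) / 2) = real q ^ (2 * m\<^sup>2 + 2 * m)" for m
    proof -
      have "((real (2 * m + 1))\<^sup>2 - 1) / 2 = real (2 * m\<^sup>2 + 2 * m)"
        by (simp add: power2_eq_square algebra_simps)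
      then show ?thesis using q by (simp only: powr_realpow of_nat_0_less_iff)
    qed
    then show "(\<lambda>m. real (i_GL TYPE('a) (2 * m + 1)) / real q powr (((real (2 * m + 1))\<^sup>2 - 1) / 2))
      \<longlonglongrightarrow> theta_odd u / euler_phi u"
      using qbinom_sum_LIMSEQ[OF u theta_odd_summable[OF u], of 1]
      unfolding theta_odd_def by (simp only: i_GL_odd[OF two, unfolded assms(3)] u_def)
  qed
qed

end
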